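(* Let $J\subsetneq S$ be a bigraded ideal and $R=S/J$. Assume that $x_1,\dots,x_n$ is an almost regular sequence for $R$ with respect to the $x$-degree and that $y_1,\dots,y_m$ is an almost regular sequence for $R$ with respect to the $y$-degree. Put $$s^x_i=\max\bigl(\{a : (0:_{R/(x_1,\dots,x_{i-1})R}\,x_i)_{(a,\ast)}\neq 0\}\cup\{0\}\bigr)\ (1\le i\le n),\qquad s^x=\max\{s^x_1,\dots,s^x_n\},$$ $$s^y_i=\max\bigl(\{b : (0:_{R/(y_1,\dots,y_{i-1})R}\,y_i)_{(\ast,b)}\neq 0\}\cup\{0\}\bigr)\ (1\le i\le m),\qquad s^y=\max\{s^y_1,\dots,s^y_m\}.$$ Then $\mathrm{reg}_x^S(R)=s^x$ and $\mathrm{reg}_y^S(R)=s^y$.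
   Context: $K$ is an infinite field and $S=K[x_1,\dots,x_n,y_1,\dots,y_m]$ is the standard bigraded polynomial ring with $\deg x_i=(1,0)$, $\deg y_j=(0,1)$. The residue classes of $x_i,y_j$ in quotients of $S$ are denoted by the same letters. For a bigraded module $M$ put $M_{(a,\ast)}=\bigoplus_{b\in\mathbb Z}M_{(a,b)}$ and $M_{(\ast,b)}=\bigoplus_{a\in\mathbb Z}M_{(a,b)}$. For a finitely generated bigraded $S$-module $M$, $\beta^S_{i,(a,b)}(M)=\dim_K\mathrm{Tor}^S_i(M,K)_{(a,b)}$, and $\mathrm{reg}_x^S(M)=\sup\{a\in\mathbb Z:\beta^S_{i,(a+i,b)}(M)\ne0\text{ for some }i,b\in\mathbb Z\}$, $\mathrm{reg}_y^S(M)=\sup\{b\in\mathbb Z:\beta^S_{i,(a,b+i)}(M)\ne0\text{ for some }i,a\in\mathbb Z\}$. For a bigraded algebra $R$ (a quotient of $S$ by a bigraded ideal), an element $x\in R_{(1,0)}$ is almost regular for $R$ with respect to the $x$-degree if $(0:_Rx)_{(a,\ast)}=0$ for all $a\gg0$. A sequence $x_1,\dots,x_t\in R_{(1,0)}$ is an almost regular sequence with respect to the $x$-degree if for every $i\in\{1,\dots,t\}$ the element $x_i$ is almost regular for $R/(x_1,\dots,x_{i-1})R$. Likewise $y\in R_{(0,1)}$ is almost regular with respect to the $y$-degree if $(0:_Ry)_{(\ast,b)}=0$ for all $b\gg0$, and $y_1,\dots,y_t\in R_{(0,1)}$ is an almost regular sequence with respect to the $y$-degree if for every $i$ the element $y_i$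 is almost regular for $R/(y_1,\dots,y_{i-1})R$. *)

theory Defs
  imports Complex_Main
    "HOL-Library.Poly_Mapping"
    "HOL-Library.Function_Algebras"
    "HOL-Library.Product_Plus"
    "HOL-Library.Extended_Real"
begin

text \<open>
  The variables of S are indexed by finite linearly ordered types: \<open>Inl i\<close> stands for
  $x_i$ and \<open>Inr j\<close> for $y_j$, with n and m the cardinalities of the index types. The order on
  the index types is the order of the sequences $x_1,\dots,x_n$ and $y_1,\dots,y_m$.
\<close>

type_synonym ('n, 'm, 'k) bipoly = "(('n + 'm) \<Rightarrow>\<^sub>0 nat) \<Rightarrow>\<^sub>0 'k"

definition xvar :: "'n \<Rightarrow> ('n, 'm, 'k::comm_ring_1) bipoly" where
  "xvar i = Poly_Mapping.single (Poly_Mapping.single (Inl i) 1) 1"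

definition yvar :: "'m \<Rightarrow> ('n, 'm, 'k::comm_ring_1) bipoly" where
  "yvar j = Poly_Mapping.single (Poly_Mapping.single (Inr j) 1) 1"

definition xdeg :: "(('n::finite + 'm::finite) \<Rightarrow>\<^sub>0 nat) \<Rightarrow> int" where
  "xdeg u = (\<Sum>i\<in>UNIV. int (Poly_Mapping.lookup u (Inl i)))"

definition ydeg :: "(('n::finite + 'm::finite) \<Rightarrow>\<^sub>0 nat) \<Rightarrow> int" where
  "ydeg u = (\<Sum>j\<in>UNIV. int (Poly_Mapping.lookup u (Inr j)))"

text \<open>\<open>bipart (a, b)\<close>, \<open>xpart a\<close>, \<open>ypart b\<close> are $S_{(a,b)}$, $S_{(a,\ast)}$, $S_{(\ast,b)}$;
  degrees are integers and a component containing no monomial is zero.\<close>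

definition bipart :: "int \<times> int \<Rightarrow> ('n::finite, 'm::finite, 'k::zero) bipoly set" where
  "bipart d = {f. \<forall>u \<in> Poly_Mapping.keys f. (xdeg u, ydeg u) = d}"

definition xpart :: "int \<Rightarrow> ('n::finite, 'm::finite, 'k::zero) bipoly set" where
  "xpart a = {f. \<forall>u \<in> Poly_Mapping.keys f. xdeg u = a}"

definition ypart :: "int \<Rightarrow> ('n::finite, 'm::finite, 'k::zero) bipoly set" where
  "ypart b = {f. \<forall>u \<in> Poly_Mapping.keys f. ydeg u = b}"

lemma module_self: "module ((*) :: 'a::comm_ring_1 \<Rightarrow> 'a \<Rightarrow> 'a)"
  by unfold_locales (simp_all add: algebra_simps)

definition is_ideal :: "'a::comm_ring_1 set \<Rightarrow> bool" where
  "is_ideal I \<longleftrightarrow> module.subspace (*) I"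

definition ideal_gen :: "'a::comm_ring_1 set \<Rightarrow> 'a set" where
  "ideal_gen G = module.span (*) G"

definition bigraded_ideal :: "('n::finite, 'm::finite, 'k::comm_ring_1) bipoly set \<Rightarrow> bool" where
  "bigraded_ideal J \<longleftrightarrow> is_ideal J \<and> (\<exists>G. (\<forall>g\<in>G. \<exists>d. g \<in> bipart d) \<and> J = ideal_gen G)"

definition residue_class :: "'a::comm_ring_1 set \<Rightarrow> 'a \<Rightarrow> 'a set" where
  "residue_class I f = {g. g - f \<in> I}"

text \<open>For a family P of graded pieces of S (\<open>xpart\<close> or \<open>ypart\<close>), this is the degree-a piece of
  $(0 :_{S/I} f)$, as a set of residue classes modulo I.\<close>

definition ann_part :: "(int \<Rightarrow> 'a::comm_ring_1 set) \<Rightarrow> 'a set \<Rightarrow> 'a \<Rightarrow> int \<Rightarrow> 'a set set" where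
  "ann_part P I f a = {residue_class I g | g. g \<in> P a \<and> residue_class I (f * g) = residue_class I 0}"

definition ann_nonzero :: "(int \<Rightarrow> 'a::comm_ring_1 set) \<Rightarrow> 'a set \<Rightarrow> 'a \<Rightarrow> int \<Rightarrow> bool" where
  "ann_nonzero P I f a \<longleftrightarrow> ann_part P I f a \<noteq> {residue_class I 0}"

definition almost_regular :: "(int \<Rightarrow> 'a::comm_ring_1 set) \<Rightarrow> 'a set \<Rightarrow> 'a \<Rightarrow> bool" where
  "almost_regular P I f \<longleftrightarrow> (\<exists>a0. \<forall>a\<ge>a0. \<not> ann_nonzero P I f a)"

text \<open>The ideal I of S with $S/I = R/(f_1,\dots,f_{i-1})R$ for $R = S/J$.\<close>

definition partial_ideal :: "'a::comm_ring_1 set \<Rightarrow> ('i::linorder \<Rightarrow> 'a) \<Rightarrow> 'i \<Rightarrow> 'a set" where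
  "partial_ideal J f i = ideal_gen (J \<union> f ` {..<i})"

definition almost_regular_seq_x ::
  "('n::finite, 'm::finite, 'k::comm_ring_1) bipoly set \<Rightarrow> ('i::linorder \<Rightarrow> ('n, 'm, 'k) bipoly) \<Rightarrow> bool"
  where "almost_regular_seq_x J f \<longleftrightarrow>
    (\<forall>i. f i \<in> bipart (1, 0) \<and> almost_regular xpart (partial_ideal J f i) (f i))"

definition almost_regular_seq_y ::
  "('n::finite, 'm::finite, 'k::comm_ring_1) bipoly set \<Rightarrow> ('i::linorder \<Rightarrow> ('n, 'm, 'k) bipoly) \<Rightarrow> bool"
  where "almost_regular_seq_y J f \<longleftrightarrow>
    (\<forall>i. f i \<in> bipart (0, 1) \<and> almost_regular ypart (partial_ideal J f i) (f i))"

definition s_x :: "('n::{finite,linorder}, 'm::finite, 'k::comm_ring_1) bipoly set \<Rightarrow> 'n \<Rightarrow> int" where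
  "s_x J i = Max ({a. ann_nonzero xpart (partial_ideal J xvar i) (xvar i) a} \<union> {0})"

definition s_y :: "('n::finite, 'm::{finite,linorder}, 'k::comm_ring_1) bipoly set \<Rightarrow> 'm \<Rightarrow> int" where
  "s_y J j = Max ({b. ann_nonzero ypart (partial_ideal J yvar j) (yvar j) b} \<union> {0})"

text \<open>
  Bigraded free resolutions
  $\cdots \to F_2 \to F_1 \to F_0 \to S/J \to 0$ by free modules of finite rank.
  The basis of $F_i$ is indexed by \<open>{..<rnk C i}\<close>, its elements having degrees \<open>bdeg C i j\<close>;
  \<open>dmat C i\<close> is the matrix of the map from $F_{i+1}$ to $F_i$ (rows indexed by the basis of $F_i$);
  \<open>aug C j\<close> is a representative in S of the image in $S/J$ of the j-th basis element of $F_0$.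
\<close>

record (overloaded) ('n, 'm, 'k) free_complex =
  rnk :: "nat \<Rightarrow> nat"
  bdeg :: "nat \<Rightarrow> nat \<Rightarrow> int \<times> int"
  dmat :: "nat \<Rightarrow> nat \<Rightarrow> nat \<Rightarrow> ('n, 'm, 'k) bipoly"
  aug :: "nat \<Rightarrow> ('n, 'm, 'k) bipoly"

definition free_mod :: "nat \<Rightarrow> (nat \<Rightarrow> 'a::zero) set" where
  "free_mod r = {v. \<forall>j\<ge>r. v j = 0}"

definition mat_map :: "nat \<Rightarrow> nat \<Rightarrow> (nat \<Rightarrow> nat \<Rightarrow> 'a::comm_ring_1) \<Rightarrow> (nat \<Rightarrow> 'a) \<Rightarrow> nat \<Rightarrow> 'a" where
  "mat_map r s A v = (\<lambda>j. if j < r then (\<Sum>k<s. A j k * v k) else 0)"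

definition diff_map ::
  "('n, 'm, 'k::comm_ring_1) free_complex \<Rightarrow> nat \<Rightarrow> (nat \<Rightarrow> ('n, 'm, 'k) bipoly) \<Rightarrow> nat \<Rightarrow> ('n, 'm, 'k) bipoly"
  where "diff_map C i = mat_map (rnk C i) (rnk C (Suc i)) (dmat C i)"

definition aug_map ::
  "('n, 'm, 'k::comm_ring_1) free_complex \<Rightarrow> (nat \<Rightarrow> ('n, 'm, 'k) bipoly) \<Rightarrow> ('n, 'm, 'k) bipoly"
  where "aug_map C v = (\<Sum>j<rnk C 0. aug C j * v j)"

definition bigraded_free_resolution ::
  "('n::finite, 'm::finite, 'k::comm_ring_1) bipoly set \<Rightarrow> ('n, 'm, 'k) free_complex \<Rightarrow> bool"
  where "bigraded_free_resolution J C \<longleftrightarrow>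
    (\<forall>j<rnk C 0. aug C j \<in> bipart (bdeg C 0 j)) \<and>
    (\<forall>i. \<forall>j<rnk C i. \<forall>k<rnk C (Suc i). dmat C i j k \<in> bipart (bdeg C (Suc i) k - bdeg C i j)) \<and>
    (\<forall>f. \<exists>v\<in>free_mod (rnk C 0). residue_class J (aug_map C v) = residue_class J f) \<and>
    {v \<in> free_mod (rnk C 0). residue_class J (aug_map C v) = residue_class J 0}
      = diff_map C 0 ` free_mod (rnk C (Suc 0)) \<and>
    (\<forall>i. {v \<in> free_mod (rnk C (Suc i)). diff_map C i v = 0}
      = diff_map C (Suc i) ` free_mod (rnk C (Suc (Suc i))))"

text \<open>
  $F_\bullet \otimes_S K$ in bidegree d, where $K = S/(x_1,\dots,x_n,y_1,\dots,y_m)$: the basis of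
  $F_i$ becomes a K-basis of $F_i \otimes_S K$, and each matrix entry is replaced by
  its image in K, i.e. its constant coefficient. \<open>tensor_cycles\<close> and \<open>tensor_boundaries\<close> are
  the degree-d parts of the kernel and the image in $F_i \otimes_S K$, so that
  their quotient is $\mathrm{Tor}^S_i(S/J,K)_d$.
\<close>

definition tensor_diff ::
  "('n, 'm, 'k::comm_ring_1) free_complex \<Rightarrow> nat \<Rightarrow> (nat \<Rightarrow> 'k) \<Rightarrow> nat \<Rightarrow> 'k"
  where "tensor_diff C i =
    mat_map (rnk C i) (rnk C (Suc i)) (\<lambda>j k. Poly_Mapping.lookup (dmat C i j k) 0)"

definition tensor_part ::
  "('n, 'm, 'k::comm_ring_1) free_complex \<Rightarrow> nat \<Rightarrow> int \<times> int \<Rightarrow> (nat \<Rightarrow> 'k) set"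
  where "tensor_part C i d = {v \<in> free_mod (rnk C i). \<forall>j. v j \<noteq> 0 \<longrightarrow> bdeg C i j = d}"

definition tensor_cycles ::
  "('n, 'm, 'k::comm_ring_1) free_complex \<Rightarrow> nat \<Rightarrow> int \<times> int \<Rightarrow> (nat \<Rightarrow> 'k) set"
  where "tensor_cycles C i d =
    {v \<in> tensor_part C i d. case i of 0 \<Rightarrow> True | Suc i' \<Rightarrow> tensor_diff C i' v = 0}"

definition tensor_boundaries ::
  "('n, 'm, 'k::comm_ring_1) free_complex \<Rightarrow> nat \<Rightarrow> int \<times> int \<Rightarrow> (nat \<Rightarrow> 'k) set"
  where "tensor_boundaries C i d = tensor_diff C i ` tensor_part C (Suc i) d"

definition vscale :: "'k::field \<Rightarrow> (nat \<Rightarrow> 'k) \<Rightarrow> nat \<Rightarrow> 'k" where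
  "vscale c v = (\<lambda>j. c * v j)"

lemma vector_space_vscale: "vector_space vscale"
  by unfold_locales (simp_all add: vscale_def plus_fun_def algebra_simps)

text \<open>The dimension of the quotient of cycles by boundaries; it does not depend on the chosen
  resolution. The boundaries are a subspace of the finite-dimensional space of cycles, so the
  subtraction does not truncate.\<close>

definition betti ::
  "('n::finite, 'm::finite, 'k::field) bipoly set \<Rightarrow> nat \<Rightarrow> int \<times> int \<Rightarrow> nat"
  where "betti J i d =
    (let C = (SOME C. bigraded_free_resolution J C)
     in vector_space.dim vscale (tensor_cycles C i d) - vector_space.dim vscale (tensor_boundaries C i d))"

definition reg_x :: "('n::finite, 'm::finite, 'k::field) bipoly set \<Rightarrow> ereal" where
  "reg_x J = Sup {ereal (real_of_int a) | a. \<exists>i b. betti J i (a + int i, b) \<noteq> 0}"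

definition reg_y :: "('n::finite, 'm::finite, 'k::field) bipoly set \<Rightarrow> ereal" where
  "reg_y J = Sup {ereal (real_of_int b) | b. \<exists>i a. betti J i (a, b + int i) \<noteq> 0}"

end

theory Submission
  imports Defs
begin

text \<open>
  Let F be a bigraded free resolution of R = S/J. For a set V of variables write F(V) for the
  complex F modulo V F. Its homology is Tor(R, S/(V)); for V empty this is R in homological degree 0
  (F is exact), for V the set of all variables it is the Tor of which the Betti numbers are the
  dimensions, and in homological degree 0 it is S/(J + (V)). If x is a variable outside V, then
  multiplication by x is injective on F(V) with cokernel F(V + x), so there is a long exact sequence
    H_i(V)(-deg x) --x--> H_i(V) --> H_i(V + x) --> H_{i-1}(V)(-deg x) --x--> H_{i-1}(V).
  Everything is read off from three consequences of it, \<open>acyclic_insert_Suc\<close>,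
  \<open>not_acyclic_insert_Suc\<close> and \<open>not_acyclic_insert\<close>.

  Consider the x-degree; s denotes the maximum of the numbers s_i.

  Upper bound. Kill x_1, ..., x_n in this order. By the sequence, killing x_k enlarges H_{i+1} only by
  the kernel of x_k on H_i, moved up by one x-degree. For i = 0 this kernel is the annihilator of x_k in
  R/(x_1, ..., x_{k-1})R, which vanishes in x-degrees above s_k; for larger i the group H_i vanishes
  above s + i by induction. So H_i vanishes in x-degrees above s + i for positive i
  (\<open>acyclic_sequence\<close>). After all x are killed this also holds for i = 0, as H_0 then lives in
  x-degree 0, and killing the y does not change x-degrees, so the bound persists (\<open>acyclic_all\<close>).

  Lower bound. If s = 0, then 1 is a nonzero class in H_0, since J is proper. If s = s_k > 0, a nonzero
  element of the annihilator of x_k in x-degree s yields a nonzero class of H_1 in x-degree s + 1.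
  When another x is killed, a nonzero class of H_i in x-degree s + i is annihilated by it, because
  its product would lie above the upper bound; so it yields a nonzero class of H_{i+1} in x-degree
  s + i + 1 (\<open>not_acyclic_sequence\<close>). When a y is killed, a class of lowest degree in the y-direction
  survives (\<open>not_acyclic_all\<close>).

  The Betti numbers are defined through a chosen resolution by free modules of finite rank, so one
  must exist. Kernels of matrices over S are finitely generated: the leading terms of their
  homogeneous elements are controlled by Dickson's lemma, and division by leading terms terminates
  because each bidegree contains finitely many monomials
  (\<open>graded_submodule_finitely_generated\<close>, \<open>bigraded_free_resolution_exists\<close>).

  The argument for the y-degree is the same with the two groups of variables exchanged. It is given
  once, for a distinguished group of variables enumerated by e and a degree \<open>\<alpha>\<close> that counts them.
\<close>

section \<open>Restricting a polynomial to a set of monomials\<close>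

definition restr :: "('a \<Rightarrow> bool) \<Rightarrow> ('a \<Rightarrow>\<^sub>0 'b::zero) \<Rightarrow> ('a \<Rightarrow>\<^sub>0 'b)" where
  "restr P = Poly_Mapping.mapp (\<lambda>u c. if P u then c else 0)"

lemma lookup_restr: "Poly_Mapping.lookup (restr P f) u = (if P u then Poly_Mapping.lookup f u else 0)"
  by (simp add: restr_def lookup_mapp when_def in_keys_iff)

lemma keys_restr: "Poly_Mapping.keys (restr P f) = {u \<in> Poly_Mapping.keys f. P u}"
  by (auto simp: in_keys_iff lookup_restr split: if_splits)

lemma restr_zero [simp]: "restr P 0 = 0"
  by (rule poly_mapping_eqI) (simp add: lookup_restr)

lemma restr_add: "restr P (f + g) = restr P f + restr P (g :: 'a \<Rightarrow>\<^sub>0 'b::monoid_add)"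
  by (rule poly_mapping_eqI) (simp add: lookup_restr lookup_add)

lemma restr_diff: "restr P (f - g) = restr P f - restr P (g :: 'a \<Rightarrow>\<^sub>0 'b::ab_group_add)"
  by (rule poly_mapping_eqI) (simp add: lookup_restr lookup_minus)

lemma restr_sum: "restr P (\<Sum>i\<in>I. f i) = (\<Sum>i\<in>I. restr P (f i :: 'a \<Rightarrow>\<^sub>0 'b::comm_monoid_add))"
  by (rule poly_mapping_eqI) (simp add: lookup_restr lookup_sum)

lemma restr_restr: "restr P (restr Q f) = restr (\<lambda>u. P u \<and> Q u) f"
  by (rule poly_mapping_eqI) (simp add: lookup_restr)

lemma restr_eq_self_iff: "restr P f = f \<longleftrightarrow> (\<forall>u\<in>Poly_Mapping.keys f. P u)"
  by (auto simp: poly_mapping_eq_iff fun_eq_iff lookup_restr in_keys_iff)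

lemma restr_eq_0_iff: "restr P f = 0 \<longleftrightarrow> (\<forall>u\<in>Poly_Mapping.keys f. \<not> P u)"
  by (auto simp: poly_mapping_eq_iff fun_eq_iff lookup_restr in_keys_iff)

text \<open>Only the products of a term in A with a term in B contribute to the left-hand side. This
  one rule covers both uses below: killing variables is multiplicative (A = B = P), and taking a
  homogeneous component commutes with multiplication by a homogeneous element.\<close>

lemma restr_mult:
  fixes f g :: "'a::comm_monoid_add \<Rightarrow>\<^sub>0 'b::comm_ring_1"
  assumes "\<And>u w. u \<in> Poly_Mapping.keys f \<Longrightarrow> w \<in> Poly_Mapping.keys g \<Longrightarrow> P (u + w) \<longleftrightarrow> A u \<and> B w"
  shows "restr P (f * g) = restr A f * restr B g"
proof -
  let ?A = "restr A f" and ?A' = "restr (\<lambda>u. \<not> A u) f"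
  let ?B = "restr B g" and ?B' = "restr (\<lambda>u. \<not> B u) g"
  have f: "f = ?A + ?A'" and g: "g = ?B + ?B'"
    by (auto intro!: poly_mapping_eqI simp: lookup_restr lookup_add)
  have "f * g = ?A * ?B + (?A * ?B' + ?A' * g)"
  proof -
    have "f * g = ?A * g + ?A' * g" using f by (metis distrib_right)
    also have "?A * g = ?A * ?B + ?A * ?B'" using g by (metis distrib_left)
    finally show ?thesis by (simp add: add.assoc)
  qed
  moreover have "restr P (?A * ?B) = ?A * ?B"
    unfolding restr_eq_self_iff using keys_mult[of ?A ?B] assms by (fastforce simp: keys_restr)
  moreover have "restr P (?A * ?B') = 0"
    unfolding restr_eq_0_iff using keys_mult[of ?A ?B'] assms by (fastforce simp: keys_restr)
  moreover have "restr P (?A' * g) = 0"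
    unfolding restr_eq_0_iff using keys_mult[of ?A' g] assms by (fastforce simp: keys_restr)
  ultimately show ?thesis by (simp add: restr_add)
qed

lemma lookup_single_mult_shift:
  fixes f :: "'a::cancel_comm_monoid_add \<Rightarrow>\<^sub>0 'b::comm_ring_1"
  shows "Poly_Mapping.lookup (Poly_Mapping.single t c * f) (t + u) = c * Poly_Mapping.lookup f u"
  by (simp add: lookup_mult lookup_single when_mult)

lemma keys_single_mult:
  fixes f :: "'a::cancel_comm_monoid_add \<Rightarrow>\<^sub>0 'b::comm_ring_1"
  assumes "u \<in> Poly_Mapping.keys (Poly_Mapping.single t c * f)"
  shows "\<exists>w\<in>Poly_Mapping.keys f. u = t + w"
  using keys_mult[of "Poly_Mapping.single t c" f] assms by (auto split: if_splits)

section \<open>The bigrading\<close>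

definition bideg :: "(('n::finite + 'm::finite) \<Rightarrow>\<^sub>0 nat) \<Rightarrow> int \<times> int" where
  "bideg u = (xdeg u, ydeg u)"

lemma bideg_0 [simp]: "bideg 0 = 0"
  by (simp add: bideg_def xdeg_def ydeg_def zero_prod_def)

lemma bideg_add: "bideg (u + w) = bideg u + bideg w"
  by (simp add: bideg_def xdeg_def ydeg_def lookup_add sum.distrib)

lemma bideg_nonneg: "0 \<le> fst (bideg u)" "0 \<le> snd (bideg u)"
  by (auto simp: bideg_def xdeg_def ydeg_def intro: sum_nonneg)

lemma bipart_iff: "f \<in> bipart d \<longleftrightarrow> (\<forall>u\<in>Poly_Mapping.keys f. bideg u = d)"
  by (simp add: bipart_def bideg_def)

text \<open>Each exponent is bounded by the degree in its group of variables.\<close>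

lemma finite_bideg: "finite {u :: ('n::finite + 'm::finite) \<Rightarrow>\<^sub>0 nat. bideg u = d}"
proof -
  define N where "N = nat (max (fst d) (snd d))"
  let ?F = "{h :: 'n + 'm \<Rightarrow> nat. \<forall>x. (x \<in> UNIV \<longrightarrow> h x \<in> {..N}) \<and> (x \<notin> UNIV \<longrightarrow> h x = 0)}"
  have "Poly_Mapping.lookup u x \<le> N" if "bideg u = d" for u :: "('n + 'm) \<Rightarrow>\<^sub>0 nat" and x
  proof (cases x)
    case (Inl i)
    have "int (Poly_Mapping.lookup u (Inl i)) \<le> xdeg u"
      unfolding xdeg_def by (rule member_le_sum) auto
    then show ?thesis using that Inl by (auto simp: N_def bideg_def)
  next
    case (Inr i)
    have "int (Poly_Mapping.lookup u (Inr i)) \<le> ydeg u"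
      unfolding ydeg_def by (rule member_le_sum) auto
    then show ?thesis using that Inr by (auto simp: N_def bideg_def)
  qed
  then have "Poly_Mapping.lookup ` {u. bideg u = d} \<subseteq> ?F" by auto
  moreover have "finite ?F" by (rule finite_set_of_finite_funs) auto
  ultimately have "finite (Poly_Mapping.lookup ` {u :: ('n + 'm) \<Rightarrow>\<^sub>0 nat. bideg u = d})"
    by (rule finite_subset)
  then show ?thesis by (rule finite_imageD) (simp add: inj_on_def)
qed

definition hcomp :: "int \<times> int \<Rightarrow> ('n::finite, 'm::finite, 'k::zero) bipoly \<Rightarrow> ('n, 'm, 'k) bipoly" where
  "hcomp d = restr (\<lambda>u. bideg u = d)"

lemma hcomp_in_bipart: "hcomp d f \<in> bipart d"
  by (simp add: hcomp_def bipart_iff keys_restr)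

lemma hcomp_id: "f \<in> bipart d \<Longrightarrow> hcomp d f = f"
  by (simp add: hcomp_def bipart_iff restr_eq_self_iff)

lemma hcomp_mult_right:
  fixes f g :: "('n::finite, 'm::finite, 'k::comm_ring_1) bipoly"
  assumes "g \<in> bipart e"
  shows "hcomp d (f * g) = hcomp (d - e) f * g"
proof -
  have "hcomp d (f * g) = hcomp (d - e) f * restr (\<lambda>_. True) g"
    unfolding hcomp_def
    by (rule restr_mult) (use assms in \<open>auto simp: bipart_iff bideg_add algebra_simps\<close>)
  then show ?thesis by (simp add: restr_eq_self_iff[THEN iffD2])
qed

lemma hcomp_mult_left:
  fixes f g :: "('n::finite, 'm::finite, 'k::comm_ring_1) bipoly"
  assumes "g \<in> bipart e"
  shows "hcomp d (g * f) = g * hcomp (d - e) f"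
  using hcomp_mult_right[OF assms, of d f] by (simp add: mult.commute)

lemma hcomp_sum: "hcomp d (\<Sum>i\<in>I. f i) = (\<Sum>i\<in>I. hcomp d (f i :: ('n::finite, 'm::finite, 'k::comm_ring_1) bipoly))"
  by (simp add: hcomp_def restr_sum)

lemma hcomp_add: "hcomp d (f + g) = hcomp d f + hcomp d (g :: ('n::finite, 'm::finite, 'k::comm_ring_1) bipoly)"
  by (simp add: hcomp_def restr_add)

lemma hcomp_diff: "hcomp d (f - g) = hcomp d f - hcomp d (g :: ('n::finite, 'm::finite, 'k::comm_ring_1) bipoly)"
  by (simp add: hcomp_def restr_diff)

lemma hcomp_zero [simp]: "hcomp d 0 = 0"
  by (simp add: hcomp_def)

lemma sum_hcomp: "(\<Sum>d\<in>bideg ` Poly_Mapping.keys f. hcomp d f) = f"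
  by (rule poly_mapping_eqI) (auto simp: lookup_sum hcomp_def lookup_restr in_keys_iff image_iff)

lemma bipart_zero [simp]: "0 \<in> bipart d"
  by (simp add: bipart_iff)

lemma bipart_add: "f \<in> bipart d \<Longrightarrow> g \<in> bipart d \<Longrightarrow> f + g \<in> bipart d"
  using keys_add[of f g] by (auto simp: bipart_iff)

lemma bipart_diff:
  fixes f g :: "('n::finite, 'm::finite, 'k::comm_ring_1) bipoly"
  shows "f \<in> bipart d \<Longrightarrow> g \<in> bipart d \<Longrightarrow> f - g \<in> bipart d"
  using hcomp_id[of f d] hcomp_id[of g d] hcomp_in_bipart[of d "f - g"] by (simp add: hcomp_diff)

lemma bipart_sum:
  "(\<And>i. i \<in> I \<Longrightarrow> f i \<in> bipart d) \<Longrightarrow> (\<Sum>i\<in>I. f i :: ('n::finite, 'm::finite, 'k::comm_ring_1) bipoly) \<in> bipart d"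
  by (induction I rule: infinite_finite_induct) (auto intro: bipart_add)

lemma bipart_mult:
  fixes f g :: "('n::finite, 'm::finite, 'k::comm_ring_1) bipoly"
  assumes "f \<in> bipart d" "g \<in> bipart e"
  shows "f * g \<in> bipart (d + e)"
  using keys_mult[of f g] assms by (fastforce simp: bipart_iff bideg_add)

lemma bipart_mult':
  fixes f g :: "('n::finite, 'm::finite, 'k::comm_ring_1) bipoly"
  assumes "f \<in> bipart d" "g \<in> bipart e" "c = d + e"
  shows "f * g \<in> bipart c"
  using bipart_mult assms by blast

section \<open>Variables and setting variables to zero\<close>

definition var :: "'n + 'm \<Rightarrow> ('n, 'm, 'k::comm_ring_1) bipoly" where
  "var x = Poly_Mapping.single (Poly_Mapping.single x 1) 1"

lemma xvar_eq_var: "xvar i = var (Inl i)" and yvar_eq_var: "yvar j = var (Inr j)"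
  by (simp_all add: xvar_def yvar_def var_def)

definition vdeg :: "'n + 'm \<Rightarrow> int \<times> int" where
  "vdeg x = (case x of Inl _ \<Rightarrow> (1, 0) | Inr _ \<Rightarrow> (0, 1))"

lemma bideg_single: "bideg (Poly_Mapping.single x (Suc 0)) = vdeg x"
  by (cases x) (auto simp: bideg_def xdeg_def ydeg_def vdeg_def lookup_single when_def if_distrib cong: if_cong)

lemma var_bipart: "var x \<in> bipart (vdeg x)"
  by (simp add: var_def bipart_iff bideg_single)

text \<open>Setting the variables of V to zero. It identifies S/(V) with the subring of polynomials
  in the remaining variables, so that quotients by variables can be computed with
  representatives.\<close>

definition proj :: "('n + 'm) set \<Rightarrow> ('n, 'm, 'k::zero) bipoly \<Rightarrow> ('n, 'm, 'k) bipoly" where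
  "proj V = restr (\<lambda>u. \<forall>x\<in>V. Poly_Mapping.lookup u x = 0)"

lemma proj_mult: "proj V (f * g) = proj V f * proj V (g :: ('n, 'm, 'k::comm_ring_1) bipoly)"
  unfolding proj_def by (rule restr_mult) (auto simp: lookup_add)

lemma proj_sum: "proj V (\<Sum>i\<in>I. f i) = (\<Sum>i\<in>I. proj V (f i :: ('n, 'm, 'k::comm_ring_1) bipoly))"
  by (simp add: proj_def restr_sum)

lemma proj_add: "proj V (f + g) = proj V f + proj V (g :: ('n, 'm, 'k::comm_ring_1) bipoly)"
  by (simp add: proj_def restr_add)

lemma proj_diff: "proj V (f - g) = proj V f - proj V (g :: ('n, 'm, 'k::comm_ring_1) bipoly)"
  by (simp add: proj_def restr_diff)

lemma proj_zero [simp]: "proj V 0 = 0"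
  by (simp add: proj_def)

lemma proj_proj: "proj V (proj W f) = proj (V \<union> W) f"
  unfolding proj_def restr_restr by (rule arg_cong[where f = "\<lambda>P. restr P f"]) auto

lemma proj_empty [simp]: "proj {} f = f"
  by (simp add: proj_def restr_eq_self_iff)

lemma proj_var [simp]:
  "x \<in> V \<Longrightarrow> proj V (var x) = 0" "x \<notin> V \<Longrightarrow> proj V (var x) = var x"
  by (auto simp: proj_def var_def restr_eq_0_iff restr_eq_self_iff lookup_single when_def)

lemma proj_bipart: "f \<in> bipart d \<Longrightarrow> proj V f \<in> bipart d"
  by (auto simp: proj_def bipart_iff keys_restr)

lemma hcomp_proj: "hcomp d (proj V f) = proj V (hcomp d f)"
  unfolding hcomp_def proj_def restr_restr by (simp add: conj_commute)

text \<open>The only monomial free of all variables is 1.\<close>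

lemma proj_UNIV: "proj UNIV f = Poly_Mapping.single 0 (Poly_Mapping.lookup f 0)"
proof (rule poly_mapping_eqI)
  fix u :: "'a + 'b \<Rightarrow>\<^sub>0 nat"
  have "(\<forall>x\<in>UNIV. Poly_Mapping.lookup u x = 0) \<longleftrightarrow> u = 0"
    by (auto intro: poly_mapping_eqI)
  then show "Poly_Mapping.lookup (proj UNIV f) u
      = Poly_Mapping.lookup (Poly_Mapping.single 0 (Poly_Mapping.lookup f 0)) u"
    by (auto simp: proj_def lookup_restr lookup_single when_def)
qed

lemma var_mult_eq_0:
  fixes f :: "('n, 'm, 'k::comm_ring_1) bipoly"
  assumes "var x * f = 0" shows "f = 0"
proof (rule poly_mapping_eqI)
  fix u
  show "Poly_Mapping.lookup f u = Poly_Mapping.lookup 0 u"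
    using lookup_single_mult_shift[of "Poly_Mapping.single x 1" 1 f u] assms by (simp add: var_def)
qed

text \<open>Division by the variable x, discarding the terms that x does not divide.\<close>

definition quo :: "'n + 'm \<Rightarrow> ('n, 'm, 'k::zero) bipoly \<Rightarrow> ('n, 'm, 'k) bipoly" where
  "quo x = Poly_Mapping.map_key (\<lambda>u. Poly_Mapping.single x 1 + u)"

lemma lookup_quo: "Poly_Mapping.lookup (quo x f) u = Poly_Mapping.lookup f (Poly_Mapping.single x 1 + u)"
  unfolding quo_def by (subst map_key.rep_eq) (auto intro: injI)

lemma split_exponent:
  assumes "Poly_Mapping.lookup u x \<noteq> (0::nat)"
  shows "u = Poly_Mapping.single x 1 + (u - Poly_Mapping.single x 1)"
  by (rule poly_mapping_eqI) (use assms in \<open>auto simp: lookup_add lookup_minus lookup_single when_def\<close>)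

lemma var_quo:
  fixes f :: "('n, 'm, 'k::comm_ring_1) bipoly"
  assumes "proj {x} f = 0"
  shows "var x * quo x f = f"
proof (rule poly_mapping_eqI)
  fix u
  show "Poly_Mapping.lookup (var x * quo x f) u = Poly_Mapping.lookup f u"
  proof (cases "Poly_Mapping.lookup u x = 0")
    case True
    have "u \<notin> Poly_Mapping.keys f" using assms True by (auto simp: proj_def restr_eq_0_iff)
    moreover have "u \<notin> Poly_Mapping.keys (var x * quo x f)"
      using True keys_single_mult[of u "Poly_Mapping.single x 1" 1 "quo x f"]
      by (auto simp: var_def lookup_add)
    ultimately show ?thesis by (simp add: in_keys_iff)
  next
    case False
    show ?thesis
    proof -
      obtain w where w: "u = Poly_Mapping.single x 1 + w" using split_exponent[OF False] by blast
      show ?thesis unfolding w var_def lookup_single_mult_shift lookup_quo by simp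
    qed
  qed
qed

lemma quo_bipart: "f \<in> bipart (d + vdeg x) \<Longrightarrow> quo x f \<in> bipart d"
  by (force simp: bipart_iff in_keys_iff lookup_quo bideg_add bideg_single)

lemma quo_proj:
  assumes "proj V f = f" shows "proj V (quo x f) = quo x f"
proof -
  have "Poly_Mapping.lookup u y = 0" if "u \<in> Poly_Mapping.keys (quo x f)" "y \<in> V" for u y
  proof -
    have "Poly_Mapping.single x 1 + u \<in> Poly_Mapping.keys f"
      using that(1) by (simp add: in_keys_iff lookup_quo)
    then have "Poly_Mapping.lookup (Poly_Mapping.single x 1 + u) y = 0"
      using assms that(2) unfolding proj_def restr_eq_self_iff by blast
    then show ?thesis by (simp add: lookup_add)
  qed
  then show ?thesis by (simp add: proj_def restr_eq_self_iff)
qed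

section \<open>Dickson's lemma and a term order\<close>

lemma nat_seq_incseq_subseq: "\<exists>\<phi>. strict_mono \<phi> \<and> incseq (\<lambda>n. s (\<phi> n :: nat) :: nat)"
proof -
  obtain \<phi> where \<phi>: "strict_mono \<phi>" "monoseq (\<lambda>n. s (\<phi> n))"
    using seq_monosub by blast
  show ?thesis
  proof (cases "incseq (\<lambda>n. s (\<phi> n))")
    case False
    then have dec: "decseq (\<lambda>n. s (\<phi> n))" using \<phi>(2) by (simp add: monoseq_iff)
    \<comment> \<open>A decreasing sequence of naturals is constant from its minimum on.\<close>
    obtain N where N: "\<And>n. s (\<phi> N) \<le> s (\<phi> n)"
      using ex_has_least_nat[of "\<lambda>_. True" 0 "\<lambda>n. s (\<phi> n)"] by auto
    have "s (\<phi> (N + n)) = s (\<phi> N)" for n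
      using N[of "N + n"] decseqD[OF dec, of N "N + n"] by simp
    then show ?thesis
      using \<phi>(1) by (intro exI[of _ "\<lambda>n. \<phi> (N + n)"]) (auto simp: strict_mono_def incseq_def)
  qed (use \<phi> in blast)
qed

text \<open>Exponents are well-quasi-ordered: passing to a subsequence for one variable after the
  other, any sequence of exponents has a subsequence that increases in all variables.\<close>

lemma exponent_good_pair:
  fixes f :: "nat \<Rightarrow> ('a::finite \<Rightarrow>\<^sub>0 nat)"
  shows "\<exists>i j. i < j \<and> (\<forall>x. Poly_Mapping.lookup (f i) x \<le> Poly_Mapping.lookup (f j) x)"
proof -
  have "\<exists>\<phi>. strict_mono \<phi> \<and> (\<forall>x\<in>X. incseq (\<lambda>n. Poly_Mapping.lookup (f (\<phi> n)) x))" if "finite X" for X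
    using that
  proof (induction X)
    case empty
    show ?case by (intro exI[of _ id]) (simp add: strict_mono_def)
  next
    case (insert x X)
    then obtain \<phi> where \<phi>: "strict_mono \<phi>" "\<forall>x\<in>X. incseq (\<lambda>n. Poly_Mapping.lookup (f (\<phi> n)) x)" by blast
    obtain \<psi> where \<psi>: "strict_mono \<psi>" "incseq (\<lambda>n. Poly_Mapping.lookup (f (\<phi> (\<psi> n))) x)"
      using nat_seq_incseq_subseq[of "\<lambda>n. Poly_Mapping.lookup (f (\<phi> n)) x"] by blast
    have "strict_mono (\<phi> \<circ> \<psi>)" using \<phi>(1) \<psi>(1) by (rule strict_mono_o)
    moreover have "incseq (\<lambda>n. Poly_Mapping.lookup (f ((\<phi> \<circ> \<psi>) n)) y)" if "y \<in> insert x X" for y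
    proof (cases "y = x")
      case False
      then have "incseq (\<lambda>n. Poly_Mapping.lookup (f (\<phi> n)) y)" using \<phi>(2) that by blast
      then show ?thesis
        using strict_mono_mono[OF \<psi>(1)] unfolding incseq_def mono_def comp_def by blast
    qed (use \<psi>(2) in simp)
    ultimately show ?case by blast
  qed
  from this[OF finite_UNIV] obtain \<phi> where \<phi>: "strict_mono \<phi>"
    "\<forall>x. incseq (\<lambda>n. Poly_Mapping.lookup (f (\<phi> n)) x)" by auto
  then have "\<phi> 0 < \<phi> 1" "\<forall>x. Poly_Mapping.lookup (f (\<phi> 0)) x \<le> Poly_Mapping.lookup (f (\<phi> 1)) x"
    by (auto simp: strict_mono_def incseq_def)
  then show ?thesis by blast
qed

text \<open>The minimal exponents in A generate it, and infinitely many of them would contain a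
  comparable pair.\<close>

lemma dickson:
  fixes A :: "('a::finite \<Rightarrow>\<^sub>0 nat) set"
  shows "\<exists>B\<subseteq>A. finite B \<and> (\<forall>a\<in>A. \<exists>b\<in>B. \<exists>w. a = b + w)"
proof -
  let ?le = "\<lambda>u w. \<forall>x. Poly_Mapping.lookup u x \<le> Poly_Mapping.lookup w x"
  let ?size = "\<lambda>u. \<Sum>x\<in>UNIV. Poly_Mapping.lookup u x"
  define B where "B = {a\<in>A. \<forall>b\<in>A. ?le b a \<longrightarrow> b = a}"
  have "finite B"
  proof (rule ccontr)
    assume "infinite B"
    then obtain f :: "nat \<Rightarrow> _" where f: "inj f" "range f \<subseteq> B"
      using infinite_countable_subset by blast
    obtain i j where ij: "i < j" "?le (f i) (f j)" using exponent_good_pair by blast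
    moreover have "f i \<in> A" "f j \<in> B" using f(2) by (auto simp: B_def)
    ultimately have "f i = f j" unfolding B_def by blast
    then show False using f(1) ij(1) by (auto dest: injD)
  qed
  moreover have "\<exists>b\<in>B. ?le b a" if "a \<in> A" for a
    using that
  proof (induction "?size a" arbitrary: a rule: less_induct)
    case less
    show ?case
    proof (cases "a \<in> B")
      case False
      then obtain b where b: "b \<in> A" "?le b a" "b \<noteq> a" using less.prems by (auto simp: B_def)
      then obtain x where "Poly_Mapping.lookup b x \<noteq> Poly_Mapping.lookup a x"
        by (blast intro: poly_mapping_eqI)
      then have "Poly_Mapping.lookup b x < Poly_Mapping.lookup a x" using b(2) by (simp add: order_less_le)
      then have "?size b < ?size a"
        using b(2) by (intro sum_strict_mono_ex1) auto
      then obtain c where "c \<in> B" "?le c b" using less.hyps b(1) by blast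
      then show ?thesis using b(2) order_trans by blast
    qed auto
  qed
  moreover have "a = b + (a - b)" if "?le b a" for a b :: "'a \<Rightarrow>\<^sub>0 nat"
    by (rule poly_mapping_eqI) (use that in \<open>simp add: lookup_add lookup_minus\<close>)
  moreover have "B \<subseteq> A" by (simp add: B_def)
  ultimately show ?thesis by meson
qed

text \<open>A translation-invariant total order on the terms (position, exponent) of vectors. The
  exponents are embedded additively into those over the natural numbers, which are ordered
  lexicographically; the position is stored as the exponent of one more variable. Reduction by
  leading terms stays within one bidegree, which has finitely many terms, so it terminates for any
  such order.\<close>

lemma term_order_exists:
  "\<exists>(\<tau> :: nat \<times> ('a::finite \<Rightarrow>\<^sub>0 nat) \<Rightarrow> (nat \<Rightarrow>\<^sub>0 nat)) \<phi>.
     inj \<tau> \<and> (\<forall>j u w. \<tau> (j, u + w) = \<tau> (j, u) + \<phi> w)"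
proof -
  obtain h :: "'a \<Rightarrow> nat" and N where h: "h ` UNIV = {i. i < N}" "inj h"
    using finite_imp_inj_to_nat_seg[OF finite_UNIV] by metis
  define \<phi> :: "('a \<Rightarrow>\<^sub>0 nat) \<Rightarrow> (nat \<Rightarrow>\<^sub>0 nat)" where
    "\<phi> u = (\<Sum>x\<in>UNIV. Poly_Mapping.single (h x) (Poly_Mapping.lookup u x))" for u
  \<comment> \<open>The index N lies outside the range of h and is free to record the position.\<close>
  define \<tau> where "\<tau> = (\<lambda>(j, u). Poly_Mapping.single N j + \<phi> u)"
  have hN: "h x \<noteq> N" for x using h(1) by blast
  have lookup_h: "Poly_Mapping.lookup (\<phi> u) (h x) = Poly_Mapping.lookup u x" for u x
  proof -
    have "Poly_Mapping.lookup (\<phi> u) (h x) = (\<Sum>y\<in>UNIV. if y = x then Poly_Mapping.lookup u y else 0)"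
      unfolding \<phi>_def lookup_sum by (rule sum.cong) (auto simp: lookup_single when_def dest: injD[OF h(2)])
    then show ?thesis by simp
  qed
  have lookup_N: "Poly_Mapping.lookup (\<phi> u) N = 0" for u
    using hN by (simp add: \<phi>_def lookup_sum lookup_single)
  have "inj \<tau>"
  proof (rule injI, clarify)
    fix j u j' u' assume eq: "\<tau> (j, u) = \<tau> (j', u')"
    have "j = j'"
      using arg_cong[OF eq, of "\<lambda>f. Poly_Mapping.lookup f N"] by (simp add: \<tau>_def lookup_add lookup_N)
    moreover have "u = u'"
    proof (rule poly_mapping_eqI)
      fix x show "Poly_Mapping.lookup u x = Poly_Mapping.lookup u' x"
        using arg_cong[OF eq, of "\<lambda>f. Poly_Mapping.lookup f (h x)"] hN[of x]
        by (simp add: \<tau>_def lookup_add lookup_h lookup_single when_def)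
    qed
    ultimately show "j = j' \<and> u = u'" by simp
  qed
  moreover have "\<phi> (u + w) = \<phi> u + \<phi> w" for u w
    by (simp add: \<phi>_def lookup_add single_add sum.distrib)
  then have "\<tau> (j, u + w) = \<tau> (j, u) + \<phi> w" for j u w
    by (simp add: \<tau>_def add.assoc)
  ultimately show ?thesis by blast
qed

section \<open>Finite generation of graded submodules\<close>

text \<open>The component of degree d in the free module whose j-th basis element has degree
  \<open>\<delta> j\<close>.\<close>

definition vcomp :: "(nat \<Rightarrow> int \<times> int) \<Rightarrow> int \<times> int \<Rightarrow> (nat \<Rightarrow> ('n::finite, 'm::finite, 'k::zero) bipoly)
    \<Rightarrow> nat \<Rightarrow> ('n, 'm, 'k) bipoly" where
  "vcomp \<delta> d v = (\<lambda>j. hcomp (d - \<delta> j) (v j))"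

definition hvec :: "nat \<Rightarrow> (nat \<Rightarrow> int \<times> int) \<Rightarrow> int \<times> int
    \<Rightarrow> (nat \<Rightarrow> ('n::finite, 'm::finite, 'k::zero) bipoly) set" where
  "hvec r \<delta> d = {v \<in> free_mod r. \<forall>j. v j \<in> bipart (d - \<delta> j)}"

definition smul :: "'a \<Rightarrow> (nat \<Rightarrow> 'a) \<Rightarrow> nat \<Rightarrow> 'a::times" where
  "smul f v = (\<lambda>j. f * v j)"

definition graded_submodule :: "nat \<Rightarrow> (nat \<Rightarrow> int \<times> int)
    \<Rightarrow> (nat \<Rightarrow> ('n::finite, 'm::finite, 'k::comm_ring_1) bipoly) set \<Rightarrow> bool" where
  "graded_submodule r \<delta> M \<longleftrightarrow> M \<subseteq> free_mod r \<and> 0 \<in> M \<and> (\<forall>v\<in>M. \<forall>w\<in>M. v + w \<in> M)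
    \<and> (\<forall>f. \<forall>v\<in>M. smul f v \<in> M) \<and> (\<forall>d. \<forall>v\<in>M. vcomp \<delta> d v \<in> M)"

definition hmatrix :: "nat \<Rightarrow> (nat \<Rightarrow> int \<times> int) \<Rightarrow> nat \<Rightarrow> (nat \<Rightarrow> int \<times> int)
    \<Rightarrow> (nat \<Rightarrow> nat \<Rightarrow> ('n::finite, 'm::finite, 'k::comm_ring_1) bipoly) \<Rightarrow> bool" where
  "hmatrix r \<delta> s \<epsilon> A \<longleftrightarrow> (\<forall>j<r. \<forall>k<s. A j k \<in> bipart (\<epsilon> k - \<delta> j))"

lemma vcomp_hvec: "v \<in> free_mod r \<Longrightarrow> vcomp \<delta> d v \<in> hvec r \<delta> d"
  by (auto simp: vcomp_def hvec_def free_mod_def hcomp_in_bipart)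

lemma vcomp_id: "v \<in> hvec r \<delta> d \<Longrightarrow> vcomp \<delta> d v = v"
  by (auto simp: vcomp_def hvec_def hcomp_id)

lemma free_mod_closed [intro]:
  fixes v w :: "nat \<Rightarrow> 'a::comm_ring_1"
  shows "0 \<in> (free_mod r :: (nat \<Rightarrow> 'a) set)"
    "v \<in> free_mod r \<Longrightarrow> w \<in> free_mod r \<Longrightarrow> v + w \<in> free_mod r"
    "v \<in> free_mod r \<Longrightarrow> w \<in> free_mod r \<Longrightarrow> v - w \<in> free_mod r"
    "v \<in> free_mod r \<Longrightarrow> smul f v \<in> free_mod r"
  by (auto simp: free_mod_def smul_def)

lemma mat_map_free_mod: "mat_map r s A v \<in> free_mod r"
  by (simp add: mat_map_def free_mod_def)

lemma mat_map_linear: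
  fixes A :: "nat \<Rightarrow> nat \<Rightarrow> 'a::comm_ring_1"
  shows "mat_map r s A 0 = 0"
    and "mat_map r s A (v + w) = mat_map r s A v + mat_map r s A w"
    and "mat_map r s A (v - w) = mat_map r s A v - mat_map r s A w"
    and "mat_map r s A (smul f v) = smul f (mat_map r s A v)"
  by (auto simp: mat_map_def smul_def fun_eq_iff algebra_simps sum.distrib sum_subtractf sum_distrib_left)

text \<open>A homogeneous matrix respects degrees, hence commutes with taking components. This is
  what turns exactness of the ungraded modules into exactness in each degree.\<close>

lemma mat_map_vcomp:
  assumes "hmatrix r \<delta> s \<epsilon> A"
  shows "mat_map r s A (vcomp \<epsilon> d v) = vcomp \<delta> d (mat_map r s A v)"
proof
  fix j
  have "A j k * hcomp (d - \<epsilon> k) (v k) = hcomp (d - \<delta> j) (A j k * v k)" if "j < r" "k < s" for k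
    using assms that by (subst hcomp_mult_left[of _ "\<epsilon> k - \<delta> j"]) (auto simp: hmatrix_def algebra_simps)
  then show "mat_map r s A (vcomp \<epsilon> d v) j = vcomp \<delta> d (mat_map r s A v) j"
    by (auto simp: mat_map_def vcomp_def hcomp_sum intro!: sum.cong)
qed

lemma mat_map_hvec:
  assumes "hmatrix r \<delta> s \<epsilon> A" "v \<in> hvec s \<epsilon> d"
  shows "mat_map r s A v \<in> hvec r \<delta> d"
  using mat_map_vcomp[OF assms(1), of d v] vcomp_id[OF assms(2)] vcomp_hvec[OF mat_map_free_mod[of r s A v], of \<delta> d]
  by simp

lemma sum_vcomp:
  assumes "v \<in> free_mod r"
  shows "\<exists>D. finite D \<and> v = (\<Sum>d\<in>D. vcomp \<delta> d v)"
proof -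
  define D where "D = (\<Union>j<r. (\<lambda>u. bideg u + \<delta> j) ` Poly_Mapping.keys (v j))"
  have fin: "finite D" by (simp add: D_def)
  have "v j = (\<Sum>d\<in>D. vcomp \<delta> d v j)" for j
  proof (rule poly_mapping_eqI)
    fix u
    have "(\<Sum>d\<in>D. Poly_Mapping.lookup (vcomp \<delta> d v j) u)
        = (\<Sum>d\<in>D. if d = bideg u + \<delta> j then Poly_Mapping.lookup (v j) u else 0)"
      by (rule sum.cong) (auto simp: vcomp_def hcomp_def lookup_restr algebra_simps)
    also have "\<dots> = Poly_Mapping.lookup (v j) u"
    proof (cases "bideg u + \<delta> j \<in> D")
      case False
      then have "Poly_Mapping.lookup (v j) u = 0"
        using assms by (cases "j < r") (fastforce simp: D_def free_mod_def in_keys_iff)+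
      then show ?thesis by (intro trans[OF sum.neutral]) auto
    qed (simp add: fin)
    finally show "Poly_Mapping.lookup (v j) u = Poly_Mapping.lookup (\<Sum>d\<in>D. vcomp \<delta> d v j) u"
      by (simp add: lookup_sum)
  qed
  moreover have "(\<Sum>d\<in>D. vcomp \<delta> d v j) = (\<Sum>d\<in>D. vcomp \<delta> d v) j" for j
    using fin by (induction D) simp_all
  ultimately have "v = (\<Sum>d\<in>D. vcomp \<delta> d v)" by (simp add: fun_eq_iff)
  with fin show ?thesis by blast
qed

lemma graded_submodule_vcomp: "graded_submodule r \<delta> M \<Longrightarrow> v \<in> M \<Longrightarrow> vcomp \<delta> d v \<in> M"
  unfolding graded_submodule_def by blast

lemma graded_submodule_diff: "graded_submodule r \<delta> M \<Longrightarrow> v \<in> M \<Longrightarrow> w \<in> M \<Longrightarrow> v - w \<in> M"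
proof -
  assume M: "graded_submodule r \<delta> M" "v \<in> M" "w \<in> M"
  have "v - w = v + smul (-1) w" by (simp add: smul_def fun_eq_iff)
  moreover have "v + smul (-1) w \<in> M" using M by (simp add: graded_submodule_def)
  ultimately show ?thesis by (simp only:)
qed

text \<open>Hilbert's basis theorem for graded submodules. For each position, Dickson's lemma gives
  finitely many homogeneous elements of M whose leading exponents divide all leading exponents of
  homogeneous elements of M. Subtracting a multiple of one of them from a homogeneous element
  removes its leading term and keeps its degree; as a degree contains finitely many terms, this ends
  at 0.\<close>

theorem graded_submodule_finitely_generated:
  fixes M :: "(nat \<Rightarrow> ('n::finite, 'm::finite, 'k::field) bipoly) set"
  assumes M: "graded_submodule r \<delta> M"
  shows "\<exists>s \<epsilon> A. hmatrix r \<delta> s \<epsilon> A \<and> M = mat_map r s A ` free_mod s"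
proof -
  obtain \<tau> :: "nat \<times> (('n + 'm) \<Rightarrow>\<^sub>0 nat) \<Rightarrow> (nat \<Rightarrow>\<^sub>0 nat)" and \<phi>
    where inj: "inj \<tau>" and \<tau>: "\<And>j u w. \<tau> (j, u + w) = \<tau> (j, u) + \<phi> w"
    using term_order_exists by blast
  define T :: "(nat \<Rightarrow> ('n, 'm, 'k) bipoly) \<Rightarrow> _" where
    "T v = {(j, u). j < r \<and> u \<in> Poly_Mapping.keys (v j)}" for v
  define leads where "leads v t \<longleftrightarrow> t \<in> T v \<and> (\<forall>t'\<in>T v. \<tau> t' \<le> \<tau> t)" for v t
  define H where "H = {v\<in>M. \<exists>d. v \<in> hvec r \<delta> d}"
  have finT: "finite (T v)" for v
  proof -
    have "T v = Sigma {..<r} (\<lambda>j. Poly_Mapping.keys (v j))" by (auto simp: T_def)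
    then show ?thesis by simp
  qed
  have M_free: "v \<in> free_mod r" if "v \<in> M" for v using M that by (auto simp: graded_submodule_def)
  have leads_exists: "\<exists>t. leads v t" if "v \<in> free_mod r" "v \<noteq> 0" for v
  proof -
    obtain j where "v j \<noteq> 0" using \<open>v \<noteq> 0\<close> by (auto simp: fun_eq_iff)
    moreover from this have "j < r" using that(1) by (auto simp: free_mod_def not_less[symmetric])
    ultimately have "T v \<noteq> {}" by (fastforce simp: T_def)
    then have "Max (\<tau> ` T v) \<in> \<tau> ` T v" using finT by (intro Max_in) auto
    then obtain t where t: "t \<in> T v" "\<tau> t = Max (\<tau> ` T v)" by auto
    then show ?thesis unfolding leads_def using finT by (intro exI[of _ t]) auto
  qed
  define L where "L j = {u. \<exists>v\<in>H. leads v (j, u)}" for j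
  have "\<forall>j. \<exists>B\<subseteq>L j. finite B \<and> (\<forall>a\<in>L j. \<exists>b\<in>B. \<exists>w. a = b + w)"
    using dickson by blast
  then obtain B where B: "\<And>j. B j \<subseteq> L j" "\<And>j. finite (B j)"
    "\<And>j a. a \<in> L j \<Longrightarrow> \<exists>b\<in>B j. \<exists>w. a = b + w"
    by metis
  have "\<forall>t. \<exists>v. snd t \<in> L (fst t) \<longrightarrow> v \<in> H \<and> leads v t"
    by (auto simp: L_def)
  then obtain G where G: "\<And>j u. u \<in> L j \<Longrightarrow> G (j, u) \<in> H \<and> leads (G (j, u)) (j, u)"
    by (metis fst_conv snd_conv)
  define \<G> where "\<G> = G ` (Sigma {..<r} B)"
  have "finite \<G>" using B(2) by (simp add: \<G>_def)
  then obtain s g where g: "\<G> = g ` {i. i < (s :: nat)}"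
    using finite_imp_nat_seg_image_inj_on by metis
  have \<G>H: "\<G> \<subseteq> H" using G B(1) by (auto simp: \<G>_def)
  then have "\<forall>k. \<exists>d. k < s \<longrightarrow> g k \<in> hvec r \<delta> d" using g by (auto simp: H_def)
  then obtain \<epsilon> where \<epsilon>: "\<And>k. k < s \<Longrightarrow> g k \<in> hvec r \<delta> (\<epsilon> k)" by metis
  define A where "A j k = g k j" for j k
  let ?S = "mat_map r s A ` free_mod s"
  have hm: "hmatrix r \<delta> s \<epsilon> A" using \<epsilon> by (auto simp: hmatrix_def A_def hvec_def)
  have S_add: "v + w \<in> ?S" if "v \<in> ?S" "w \<in> ?S" for v w
    using that mat_map_linear(2)[of r s A] by (auto simp: image_iff) (metis free_mod_closed(2))
  have S_smul: "smul f v \<in> ?S" if "v \<in> ?S" for v f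
    using that mat_map_linear(4)[of r s A] by (auto simp: image_iff) (metis free_mod_closed(4))
  have S_zero: "0 \<in> ?S" using mat_map_linear(1)[of r s A] free_mod_closed(1) by (metis image_eqI)
  have S_gen: "v \<in> ?S" if v\<G>: "v \<in> \<G>" for v
  proof -
    obtain k where k: "k < s" "v = g k" using v\<G> unfolding g by auto
    then have "v \<in> free_mod r" using \<epsilon> by (auto simp: hvec_def)
    then have "mat_map r s A (\<lambda>i. if i = k then 1 else 0) = v"
      using k by (auto simp: mat_map_def A_def fun_eq_iff free_mod_def if_distrib cong: if_cong)
    moreover have "(\<lambda>i. if i = k then 1 else 0) \<in> free_mod s" using k by (simp add: free_mod_def)
    ultimately show ?thesis by (rule image_eqI[OF sym])
  qed
  have hom: "v \<in> ?S" if "v \<in> M" "v \<in> hvec r \<delta> d" for v d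
  proof -
    define Td :: "(nat \<times> (('n + 'm) \<Rightarrow>\<^sub>0 nat)) set" where "Td = {(j, u). j < r \<and> bideg u = d - \<delta> j}"
    have "Td = Sigma {..<r} (\<lambda>j. {u. bideg u = d - \<delta> j})" by (auto simp: Td_def)
    then have finTd: "finite Td" by (simp add: finite_bideg)
    \<comment> \<open>Termination measure: the terms of degree d up to the leading term.\<close>
    define m where "m v = {t\<in>Td. \<exists>t'\<in>T v. \<tau> t \<le> \<tau> t'}" for v
    show ?thesis using that
    proof (induction "card (m v)" arbitrary: v rule: less_induct)
      case less
      show ?case
      proof (cases "v = 0")
        case False
        have vH: "v \<in> H" using less.prems unfolding H_def by blast
        obtain j u where lead: "leads v (j, u)"
          using leads_exists[OF M_free[OF less.prems(1)] False] by (metis surj_pair)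
        then have ju: "j < r" "u \<in> Poly_Mapping.keys (v j)" by (auto simp: leads_def T_def)
        have "u \<in> L j" using lead vH by (auto simp: L_def)
        then obtain b w where b: "b \<in> B j" "u = b + w" using B(3) by blast
        define h where "h = G (j, b)"
        have h: "h \<in> H" "leads h (j, b)" using G B(1) b(1) by (auto simp: h_def)
        have hS: "h \<in> ?S" using b(1) ju(1) by (intro S_gen) (auto simp: h_def \<G>_def)
        \<comment> \<open>The multiple of h whose leading term is that of v.\<close>
        define c where "c = Poly_Mapping.lookup (v j) u / Poly_Mapping.lookup (h j) b"
        have hb: "Poly_Mapping.lookup (h j) b \<noteq> 0" using h(2) by (auto simp: leads_def T_def in_keys_iff)
        define q where "q = Poly_Mapping.single w c"
        define v' where "v' = v - smul q h"
        obtain e where e: "h \<in> hvec r \<delta> e" "h \<in> M" using h(1) by (auto simp: H_def)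
        have "bideg b = e - \<delta> j" using e(1) hb by (auto simp: hvec_def bipart_iff in_keys_iff)
        moreover have "bideg u = d - \<delta> j" using less.prems(2) ju by (auto simp: hvec_def bipart_iff)
        ultimately have deg: "bideg w + e = d" using b(2) by (simp add: bideg_add prod_eq_iff)
        have "q * h i \<in> bipart (d - \<delta> i)" for i
          using e(1) deg by (intro bipart_mult'[of _ "bideg w" _ "e - \<delta> i"])
            (auto simp: q_def bipart_iff hvec_def)
        then have "smul q h \<in> hvec r \<delta> d"
          using e(1) by (auto simp: hvec_def smul_def free_mod_def)
        then have v'h: "v' \<in> hvec r \<delta> d"
          using less.prems(2) by (auto simp: v'_def hvec_def intro: bipart_diff)
        have v'M: "v' \<in> M" unfolding v'_def
          using M e(2) less.prems(1) by (intro graded_submodule_diff[OF M]) (auto simp: graded_submodule_def)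
        have below: "\<tau> t < \<tau> (j, u)" if t: "t \<in> T v'" for t
        proof -
          obtain i p where ip: "t = (i, p)" by (cases t)
          have p: "i < r" "p \<in> Poly_Mapping.keys (v i - q * h i)"
            using t by (auto simp: ip T_def v'_def smul_def)
          have "\<tau> t \<le> \<tau> (j, u)"
          proof (cases "p \<in> Poly_Mapping.keys (v i)")
            case True
            then show ?thesis using lead p(1) by (auto simp: ip leads_def T_def)
          next
            case False
            then have "p \<in> Poly_Mapping.keys (q * h i)" using p(2) keys_diff[of "v i" "q * h i"] by blast
            then obtain p' where p': "p' \<in> Poly_Mapping.keys (h i)" "p = w + p'"
              unfolding q_def using keys_single_mult by blast
            then have "\<tau> (i, p') \<le> \<tau> (j, b)" using h(2) p(1) by (auto simp: leads_def T_def)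
            then have "\<tau> (i, p' + w) \<le> \<tau> (j, b + w)" unfolding \<tau> by (rule add_right_mono)
            then show ?thesis using p'(2) b(2) by (simp add: ip add.commute)
          qed
          moreover have "t \<noteq> (j, u)"
          proof
            assume "t = (j, u)"
            moreover have "Poly_Mapping.lookup (q * h j) u = c * Poly_Mapping.lookup (h j) b"
              unfolding q_def b(2) by (subst add.commute) (rule lookup_single_mult_shift)
            ultimately show False using p(2) hb by (auto simp: ip c_def in_keys_iff lookup_minus)
          qed
          then have "\<tau> t \<noteq> \<tau> (j, u)" using inj by (auto dest: injD)
          ultimately show ?thesis by simp
        qed
        have "(j, u) \<in> m v"
          using ju \<open>bideg u = d - \<delta> j\<close> by (auto simp: m_def Td_def T_def)
        moreover have "(j, u) \<notin> m v'" using below by (force simp: m_def)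
        moreover have "m v' \<subseteq> m v"
        proof
          fix t assume t: "t \<in> m v'"
          then obtain t' where "t' \<in> T v'" "\<tau> t \<le> \<tau> t'" by (auto simp: m_def)
          with below[of t'] have "\<tau> t \<le> \<tau> (j, u)" by simp
          then show "t \<in> m v" using t lead unfolding m_def leads_def by blast
        qed
        ultimately have "m v' \<subset> m v" by blast
        then have "card (m v') < card (m v)" using finTd by (intro psubset_card_mono) (auto simp: m_def)
        then have "v' \<in> ?S" by (rule less.hyps[OF _ v'M v'h])
        then have "v' + smul q h \<in> ?S" by (rule S_add[OF _ S_smul[OF hS]])
        then show ?thesis by (simp add: v'_def)
      qed (simp add: S_zero)
    qed
  qed
  have "M \<subseteq> ?S"
  proof
    fix v assume v: "v \<in> M"
    obtain D where D: "finite D" "v = (\<Sum>d\<in>D. vcomp \<delta> d v)" using sum_vcomp[OF M_free[OF v]] by blast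
    have "(\<Sum>d\<in>D. vcomp \<delta> d v) \<in> ?S" using D(1)
    proof (induction D)
      case empty
      show ?case unfolding sum.empty by (rule S_zero)
    next
      case (insert d D)
      have "vcomp \<delta> d v \<in> ?S"
        by (intro hom[of _ d] vcomp_hvec M_free graded_submodule_vcomp[OF M] v)
      then show ?case unfolding sum.insert[OF insert.hyps] by (rule S_add[OF _ insert.IH])
    qed
    then show "v \<in> ?S" using D(2) by simp
  qed
  moreover have "?S \<subseteq> M"
  proof clarify
    fix v :: "nat \<Rightarrow> ('n, 'm, 'k) bipoly"
    have gM: "g k \<in> M" if "k < s" for k using that g \<G>H by (auto simp: H_def)
    have "mat_map r s A v = (\<Sum>k<s. smul (v k) (g k))"
    proof
      fix j
      have "(\<Sum>k<s. smul (v k) (g k)) j = (\<Sum>k<s. v k * g k j)"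
        by (induction s) (auto simp: smul_def)
      moreover have "g k j = 0" if "k < s" "j \<ge> r" for k
        using M_free[OF gM[OF that(1)]] that(2) by (simp add: free_mod_def)
      ultimately show "mat_map r s A v j = (\<Sum>k<s. smul (v k) (g k)) j"
        by (auto simp: mat_map_def A_def mult.commute)
    qed
    moreover have "(\<Sum>k<s. smul (v k) (g k)) \<in> M"
      using gM
    proof (induction s)
      case 0
      then show ?case using M unfolding graded_submodule_def by (simp only: lessThan_0 sum.empty)
    next
      case (Suc s)
      then have "(\<Sum>k<s. smul (v k) (g k)) \<in> M" "smul (v s) (g s) \<in> M"
        using M by (auto simp: graded_submodule_def)
      then show ?case using M unfolding graded_submodule_def sum.lessThan_Suc by blast
    qed
    ultimately show "mat_map r s A v \<in> M" by simp
  qed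
  ultimately show ?thesis using hm by blast
qed

lemma graded_submodule_kernel:
  assumes "hmatrix r \<delta> s \<epsilon> A"
  shows "graded_submodule s \<epsilon> {v \<in> free_mod s. mat_map r s A v = 0}"
  unfolding graded_submodule_def
  using vcomp_hvec[of _ s \<epsilon>]
  by (auto simp: mat_map_linear mat_map_vcomp[OF assms] free_mod_closed hvec_def)
     (auto simp: smul_def vcomp_def)

section \<open>Ideals\<close>

lemma is_ideal_iff:
  "is_ideal I \<longleftrightarrow> 0 \<in> I \<and> (\<forall>a\<in>I. \<forall>b\<in>I. a + b \<in> I) \<and> (\<forall>c. \<forall>a\<in>I. c * a \<in> I)"
  unfolding is_ideal_def module.subspace_def[OF module_self] by blast

lemma ideal_gen_ideal: "is_ideal (ideal_gen G)"
  unfolding is_ideal_def ideal_gen_def by (rule module.subspace_span[OF module_self])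

lemma ideal_gen_superset: "g \<in> G \<Longrightarrow> g \<in> ideal_gen G"
  unfolding ideal_gen_def by (rule module.span_base[OF module_self])

lemma ideal_gen_subset: "G \<subseteq> I \<Longrightarrow> is_ideal I \<Longrightarrow> ideal_gen G \<subseteq> I"
  unfolding is_ideal_def ideal_gen_def by (rule module.span_minimal[OF module_self])

lemma ideal_closed:
  assumes "is_ideal I"
  shows "0 \<in> I" "a \<in> I \<Longrightarrow> b \<in> I \<Longrightarrow> a + b \<in> I" "a \<in> I \<Longrightarrow> c * a \<in> I" "a \<in> I \<Longrightarrow> a * c \<in> I"
    "a \<in> I \<Longrightarrow> b \<in> I \<Longrightarrow> a - b \<in> I"
proof -
  show "0 \<in> I" "a \<in> I \<Longrightarrow> b \<in> I \<Longrightarrow> a + b \<in> I" "a \<in> I \<Longrightarrow> c * a \<in> I"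
    using assms by (auto simp: is_ideal_iff)
  show "a \<in> I \<Longrightarrow> a * c \<in> I" using assms by (metis is_ideal_iff mult.commute)
  assume "a \<in> I" "b \<in> I"
  then have "a + (-1) * b \<in> I" using assms by (auto simp only: is_ideal_iff)
  then show "a - b \<in> I" by simp
qed

lemma ideal_sum:
  assumes "is_ideal I"
  shows "(\<And>x. x \<in> X \<Longrightarrow> f x \<in> I) \<Longrightarrow> sum f X \<in> I"
  by (induction X rule: infinite_finite_induct) (auto intro: ideal_closed[OF assms])

lemma ideal_diff_left_iff:
  assumes "is_ideal I" "a - b \<in> I"
  shows "a \<in> I \<longleftrightarrow> b \<in> I"
  using ideal_closed(2)[OF assms, of b] ideal_closed(5)[OF assms(1) _ assms(2), of a] by auto

lemma residue_class_eq_iff: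
  assumes "is_ideal I"
  shows "residue_class I a = residue_class I b \<longleftrightarrow> a - b \<in> I"
proof
  assume "residue_class I a = residue_class I b"
  moreover have "a \<in> residue_class I a" using ideal_closed(1)[OF assms] by (simp add: residue_class_def)
  ultimately show "a - b \<in> I" by (simp add: residue_class_def)
next
  assume ab: "a - b \<in> I"
  have "g - a \<in> I \<longleftrightarrow> g - b \<in> I" for g
    using ideal_closed(2)[OF assms _ ab, of "g - a"] ideal_closed(5)[OF assms _ ab, of "g - b"] by auto
  then show "residue_class I a = residue_class I b" by (simp add: residue_class_def)
qed

definition hclosed :: "('n::finite, 'm::finite, 'k::comm_ring_1) bipoly set \<Rightarrow> bool" where
  "hclosed I \<longleftrightarrow> (\<forall>d. \<forall>f\<in>I. hcomp d f \<in> I)"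

lemma hcomp_mult:
  "hcomp d (c * f) = (\<Sum>e\<in>bideg ` Poly_Mapping.keys c. hcomp e c * hcomp (d - e) f)"
  for c f :: "('n::finite, 'm::finite, 'k::comm_ring_1) bipoly"
proof -
  have "hcomp d (c * f) = hcomp d ((\<Sum>e\<in>bideg ` Poly_Mapping.keys c. hcomp e c) * f)"
    by (simp only: sum_hcomp)
  then show ?thesis
    by (simp add: sum_distrib_right hcomp_sum hcomp_mult_left[OF hcomp_in_bipart])
qed

text \<open>The elements whose components all lie in the ideal form an ideal themselves, by the
  formula for the components of a product.\<close>

lemma hclosed_ideal_gen:
  assumes "\<And>g d. g \<in> G \<Longrightarrow> hcomp d g \<in> ideal_gen G"
  shows "hclosed (ideal_gen G)"
proof -
  let ?I = "{f. \<forall>d. hcomp d f \<in> ideal_gen G}"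
  have "is_ideal ?I"
    unfolding is_ideal_iff
  proof (intro conjI ballI allI CollectI)
    fix a c d assume "a \<in> ?I"
    then show "hcomp d (c * a) \<in> ideal_gen G"
      unfolding hcomp_mult by (intro ideal_sum ideal_closed(3) ideal_gen_ideal) blast
  qed (simp_all add: hcomp_add ideal_closed[OF ideal_gen_ideal] del: split_paired_All)
  moreover have "G \<subseteq> ?I" using assms by blast
  ultimately have "ideal_gen G \<subseteq> ?I" by (rule ideal_gen_subset[rotated])
  then show ?thesis unfolding hclosed_def by blast
qed

lemma hcomp_bipart: "f \<in> bipart e \<Longrightarrow> hcomp d f = (if d = e then f else 0)"
  by (auto simp: hcomp_def bipart_iff restr_eq_self_iff restr_eq_0_iff)

lemma bigraded_ideal_hclosed:
  assumes "bigraded_ideal J" shows "is_ideal J" "hclosed J"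
proof -
  obtain G where G: "\<forall>g\<in>G. \<exists>d. g \<in> bipart d" "J = ideal_gen G" "is_ideal J"
    using assms by (auto simp: bigraded_ideal_def)
  have "hcomp d g \<in> ideal_gen G" if "g \<in> G" for g d
    using G(1) that hcomp_bipart[of g] ideal_gen_superset[OF that] ideal_closed(1)[OF ideal_gen_ideal]
    by (metis (no_types))
  then show "hclosed J" unfolding G(2) by (rule hclosed_ideal_gen)
  show "is_ideal J" by (rule G(3))
qed

text \<open>The ideal J + (V), so that S modulo it is R/(V)R.\<close>

definition plus_vars :: "('n::finite, 'm::finite, 'k::comm_ring_1) bipoly set \<Rightarrow> ('n + 'm) set
    \<Rightarrow> ('n, 'm, 'k) bipoly set" where
  "plus_vars J V = ideal_gen (J \<union> var ` V)"

lemma plus_vars_ideal: "is_ideal (plus_vars J V)"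
  unfolding plus_vars_def by (rule ideal_gen_ideal)

lemma plus_vars_hclosed:
  assumes "hclosed J" shows "hclosed (plus_vars J V)"
  unfolding plus_vars_def
proof (rule hclosed_ideal_gen)
  fix g d assume "g \<in> J \<union> var ` V"
  then show "hcomp d g \<in> ideal_gen (J \<union> var ` V)"
  proof
    assume "g \<in> J"
    then have "hcomp d g \<in> J" using assms unfolding hclosed_def by blast
    then show ?thesis by (intro ideal_gen_superset) simp
  next
    assume "g \<in> var ` V"
    then have "hcomp d g = g \<or> hcomp d g = 0" using hcomp_bipart[OF var_bipart] by (metis imageE)
    then show ?thesis using \<open>g \<in> var ` V\<close>
      by (auto intro: ideal_gen_superset ideal_closed(1)[OF ideal_gen_ideal])
  qed
qed

text \<open>Every monomial of h is divisible by a variable in V.\<close>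

lemma proj_0_in_plus_vars:
  fixes h :: "('n::finite, 'm::finite, 'k::comm_ring_1) bipoly"
  assumes "proj V h = 0" shows "h \<in> plus_vars J V"
proof -
  have h: "(\<Sum>u\<in>Poly_Mapping.keys h. Poly_Mapping.single u (Poly_Mapping.lookup h u)) = h"
    by (rule poly_mapping_eqI) (auto simp: lookup_sum lookup_single when_def in_keys_iff)
  have "Poly_Mapping.single u (Poly_Mapping.lookup h u) \<in> plus_vars J V"
    if u: "u \<in> Poly_Mapping.keys h" for u
  proof -
    obtain x where x: "x \<in> V" "Poly_Mapping.lookup u x \<noteq> 0"
      using assms u by (auto simp: proj_def restr_eq_0_iff)
    let ?f = "Poly_Mapping.single u (Poly_Mapping.lookup h u)"
    have "proj {x} ?f = 0" using x(2) by (auto simp: proj_def restr_eq_0_iff)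
    then have f: "var x * quo x ?f = ?f" by (rule var_quo)
    have "var x \<in> plus_vars J V" unfolding plus_vars_def using x(1) by (intro ideal_gen_superset) auto
    then have "var x * quo x ?f \<in> plus_vars J V" by (rule ideal_closed(4)[OF plus_vars_ideal])
    then show ?thesis unfolding f .
  qed
  then have "(\<Sum>u\<in>Poly_Mapping.keys h. Poly_Mapping.single u (Poly_Mapping.lookup h u)) \<in> plus_vars J V"
    by (rule ideal_sum[OF plus_vars_ideal])
  then show ?thesis unfolding h .
qed

section \<open>Existence of bigraded free resolutions\<close>

lemma bigraded_free_resolution_iff:
  assumes "is_ideal J"
  shows "bigraded_free_resolution J C \<longleftrightarrow>
    (\<forall>j<rnk C 0. aug C j \<in> bipart (bdeg C 0 j)) \<and>
    (\<forall>i. hmatrix (rnk C i) (bdeg C i) (rnk C (Suc i)) (bdeg C (Suc i)) (dmat C i)) \<and>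
    (\<forall>f. \<exists>v\<in>free_mod (rnk C 0). aug_map C v - f \<in> J) \<and>
    {v \<in> free_mod (rnk C 0). aug_map C v \<in> J} = diff_map C 0 ` free_mod (rnk C (Suc 0)) \<and>
    (\<forall>i. {v \<in> free_mod (rnk C (Suc i)). diff_map C i v = 0}
      = diff_map C (Suc i) ` free_mod (rnk C (Suc (Suc i))))"
  unfolding bigraded_free_resolution_def residue_class_eq_iff[OF assms] hmatrix_def diff_zero by blast

text \<open>Start with the free module of rank one on a generator of degree 0, whose kernel onto S/J
  is J, and repeatedly choose finitely many homogeneous generators of the kernel of the last map. A
  state of the recursion is a homogeneous matrix together with the ranks and degrees of its source
  and target.\<close>

theorem bigraded_free_resolution_exists:
  fixes J :: "('n::finite, 'm::finite, 'k::field) bipoly set"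
  assumes "bigraded_ideal J"
  shows "\<exists>C. bigraded_free_resolution J C"
proof -
  note J = bigraded_ideal_hclosed[OF assms]
  define P where "P n x = (case x of (r, \<delta>, s, \<epsilon>, A) \<Rightarrow> hmatrix r \<delta> s \<epsilon> A \<and>
      (n = 0 \<longrightarrow> r = 1 \<and> \<delta> = (\<lambda>_. 0) \<and>
        {v \<in> free_mod 1. v 0 \<in> J} = mat_map r s A ` free_mod s))"
    for n :: nat and x :: "nat \<times> (nat \<Rightarrow> int \<times> int) \<times> nat \<times> (nat \<Rightarrow> int \<times> int)
      \<times> (nat \<Rightarrow> nat \<Rightarrow> ('n, 'm, 'k) bipoly)"
  define Q where "Q x y = (case (x, y) of ((r, \<delta>, s, \<epsilon>, A), (r', \<delta>', s', \<epsilon>', A')) \<Rightarrow>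
      r' = s \<and> \<delta>' = \<epsilon> \<and> {v \<in> free_mod s. mat_map r s A v = 0} = mat_map r' s' A' ` free_mod s')"
    for x y :: "nat \<times> (nat \<Rightarrow> int \<times> int) \<times> nat \<times> (nat \<Rightarrow> int \<times> int)
      \<times> (nat \<Rightarrow> nat \<Rightarrow> ('n, 'm, 'k) bipoly)"
  have "graded_submodule 1 (\<lambda>_. 0) {v \<in> free_mod 1. v 0 \<in> J}"
    unfolding graded_submodule_def
    using J(2) ideal_closed[OF J(1)]
    by (auto simp: free_mod_def smul_def vcomp_def hclosed_def)
  then obtain s \<epsilon> A where "hmatrix 1 (\<lambda>_. 0) s \<epsilon> A" "{v \<in> free_mod 1. v 0 \<in> J} = mat_map 1 s A ` free_mod s"
    using graded_submodule_finitely_generated by blast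
  then have base: "\<exists>x. P 0 x" by (intro exI[of _ "(1, \<lambda>_. 0, s, \<epsilon>, A)"]) (simp add: P_def)
  have step: "\<exists>y. P (Suc n) y \<and> Q x y" if "P n x" for n x
  proof -
    obtain r \<delta> s \<epsilon> A where x: "x = (r, \<delta>, s, \<epsilon>, A)" by (cases x) auto
    then have "hmatrix r \<delta> s \<epsilon> A" using that by (simp add: P_def)
    from graded_submodule_finitely_generated[OF graded_submodule_kernel[OF this]]
    obtain s' \<epsilon>' A' where "hmatrix s \<epsilon> s' \<epsilon>' A'"
      "{v \<in> free_mod s. mat_map r s A v = 0} = mat_map s s' A' ` free_mod s'" by blast
    then show ?thesis by (intro exI[of _ "(s, \<epsilon>, s', \<epsilon>', A')"]) (simp add: P_def Q_def x)
  qed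
  obtain F where F: "\<And>n. P n (F n)" "\<And>n. Q (F n) (F (Suc n))"
    using dependent_nat_choice[of P "\<lambda>_. Q"] base step by metis
  define C :: "('n, 'm, 'k) free_complex" where
    "C = \<lparr>rnk = (\<lambda>n. fst (F n)), bdeg = (\<lambda>n. fst (snd (F n))),
      dmat = (\<lambda>n. snd (snd (snd (snd (F n))))), aug = (\<lambda>_. 1)\<rparr>"
  have FC: "F n = (rnk C n, bdeg C n, rnk C (Suc n), bdeg C (Suc n), dmat C n)" for n
  proof -
    obtain r \<delta> s \<epsilon> A where x: "F n = (r, \<delta>, s, \<epsilon>, A)" by (cases "F n") auto
    obtain r' \<delta>' s' \<epsilon>' A' where y: "F (Suc n) = (r', \<delta>', s', \<epsilon>', A')" by (cases "F (Suc n)") auto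
    show ?thesis using F(2)[of n] by (simp add: C_def Q_def x y)
  qed
  have zero: "rnk C 0 = 1" "bdeg C 0 = (\<lambda>_. 0)"
    "{v \<in> free_mod 1. v 0 \<in> J} = diff_map C 0 ` free_mod (rnk C (Suc 0))"
    using F(1)[of 0] unfolding P_def FC diff_map_def by auto
  have "aug C = (\<lambda>_. 1)" by (simp add: C_def)
  then have aug: "aug_map C v = v 0" for v by (simp add: aug_map_def zero)
  have "bigraded_free_resolution J C"
    unfolding bigraded_free_resolution_iff[OF J(1)]
  proof (intro conjI allI impI)
    show "aug C j \<in> bipart (bdeg C 0 j)" for j
      unfolding zero by (simp add: C_def bipart_iff)
    show "hmatrix (rnk C i) (bdeg C i) (rnk C (Suc i)) (bdeg C (Suc i)) (dmat C i)" for i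
      using F(1)[of i] unfolding P_def FC by auto
    show "\<exists>v\<in>free_mod (rnk C 0). aug_map C v - f \<in> J" for f
      using ideal_closed(1)[OF J(1)]
      by (intro bexI[of _ "\<lambda>j. if j = 0 then f else 0"]) (auto simp: aug zero free_mod_def)
    show "{v \<in> free_mod (rnk C 0). aug_map C v \<in> J} = diff_map C 0 ` free_mod (rnk C (Suc 0))"
      unfolding aug zero(1) by (rule zero(3))
    show "{v \<in> free_mod (rnk C (Suc i)). diff_map C i v = 0}
      = diff_map C (Suc i) ` free_mod (rnk C (Suc (Suc i)))" for i
      using F(2)[of i] unfolding Q_def FC diff_map_def by auto
  qed
  then show ?thesis by blast
qed

section \<open>Resolutions modulo sets of variables\<close>

definition vproj :: "('n + 'm) set \<Rightarrow> (nat \<Rightarrow> ('n, 'm, 'k::comm_ring_1) bipoly) \<Rightarrow> nat \<Rightarrow> ('n, 'm, 'k) bipoly" where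
  "vproj V v = (\<lambda>j. proj V (v j))"

lemma vproj_linear:
  "vproj V 0 = 0" "vproj V (v + w) = vproj V v + vproj V w" "vproj V (v - w) = vproj V v - vproj V w"
  "vproj V (smul f v) = smul (proj V f) (vproj V v)"
  by (auto simp: vproj_def smul_def proj_add proj_diff proj_mult)

lemma vproj_smul_var: "x \<in> V \<Longrightarrow> vproj V (smul (var x) v) = 0"
  by (simp add: vproj_linear) (simp add: smul_def fun_eq_iff)

lemma vproj_vproj: "V \<subseteq> W \<Longrightarrow> vproj W (vproj V v) = vproj W v"
  "V \<subseteq> W \<Longrightarrow> vproj V (vproj W v) = vproj W v"
  by (auto simp: vproj_def proj_proj Un_absorb1 Un_absorb2)

lemma vproj_empty [simp]: "vproj {} v = v"
  by (simp add: vproj_def)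

lemma vproj_hvec: "v \<in> hvec r \<delta> d \<Longrightarrow> vproj V v \<in> hvec r \<delta> d"
  by (auto simp: hvec_def vproj_def free_mod_def proj_bipart)

lemma vproj_free_mod: "v \<in> free_mod r \<Longrightarrow> vproj V v \<in> free_mod r"
  by (auto simp: vproj_def free_mod_def)

lemma vproj_vcomp: "vproj V (vcomp \<delta> d v) = vcomp \<delta> d (vproj V v)"
  by (simp add: vproj_def vcomp_def hcomp_proj)

text \<open>The maps of the resolution descend to the quotients by variables.\<close>

lemma vproj_mat_map:
  assumes "V \<subseteq> W" shows "vproj W (mat_map r s A (vproj V v)) = vproj W (mat_map r s A v)"
proof -
  have "proj W (proj V f) = proj W f" for f :: "('a, 'b, 'c) bipoly"
    using assms by (simp add: proj_proj Un_absorb2)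
  then show ?thesis by (auto simp: vproj_def mat_map_def fun_eq_iff proj_sum proj_mult)
qed

lemma hvec_closed:
  fixes v w :: "nat \<Rightarrow> ('n::finite, 'm::finite, 'k::comm_ring_1) bipoly"
  shows "0 \<in> (hvec r \<delta> d :: (nat \<Rightarrow> ('n, 'm, 'k) bipoly) set)"
    "v \<in> hvec r \<delta> d \<Longrightarrow> w \<in> hvec r \<delta> d \<Longrightarrow> v + w \<in> hvec r \<delta> d"
    "v \<in> hvec r \<delta> d \<Longrightarrow> w \<in> hvec r \<delta> d \<Longrightarrow> v - w \<in> hvec r \<delta> d"
  by (auto simp: hvec_def free_mod_closed bipart_add bipart_diff)

lemma hvec_smul_var:
  assumes "v \<in> hvec r \<delta> d" shows "smul (var x) v \<in> hvec r \<delta> (d + vdeg x)"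
proof -
  have "var x * v j \<in> bipart (d + vdeg x - \<delta> j)" for j
    using assms by (intro bipart_mult'[OF var_bipart, of _ "d - \<delta> j"]) (auto simp: hvec_def algebra_simps)
  then show ?thesis using assms by (auto simp: hvec_def smul_def free_mod_def)
qed

text \<open>Exactness in the middle of the sequence that is multiplication by x followed by killing
  x.\<close>

lemma hvec_split_var:
  assumes "v \<in> hvec r \<delta> (d + vdeg x)" "vproj {x} v = 0"
  obtains w where "w \<in> hvec r \<delta> d" "v = smul (var x) w" "\<And>V. vproj V v = v \<Longrightarrow> vproj V w = w"
proof (rule that[of "\<lambda>j. quo x (v j)"])
  have "quo x (v j) \<in> bipart (d - \<delta> j)" for j
    using assms(1) by (intro quo_bipart) (simp add: hvec_def algebra_simps)
  then show "(\<lambda>j. quo x (v j)) \<in> hvec r \<delta> d"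
    using assms(1) by (auto simp: hvec_def free_mod_def quo_def)
  have "proj {x} (v j) = 0" for j using assms(2) by (simp add: vproj_def fun_eq_iff)
  then show "v = smul (var x) (\<lambda>j. quo x (v j))" by (simp add: smul_def var_quo)
  show "vproj V (\<lambda>j. quo x (v j)) = (\<lambda>j. quo x (v j))" if "vproj V v = v" for V
    using that by (auto simp: vproj_def fun_eq_iff quo_proj)
qed

lemma smul_var_eq_0: "smul (var x) v = 0 \<Longrightarrow> v = (0 :: nat \<Rightarrow> ('n, 'm, 'k::comm_ring_1) bipoly)"
  using var_mult_eq_0 by (auto simp: smul_def fun_eq_iff)

lemma smul_var_cancel: "smul (var x) v = smul (var x) w \<Longrightarrow> v = (w :: nat \<Rightarrow> ('n, 'm, 'k::comm_ring_1) bipoly)"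
proof -
  assume "smul (var x) v = smul (var x) w"
  then have "smul (var x) (v - w) = 0" by (simp add: smul_def fun_eq_iff algebra_simps)
  then show "v = w" using smul_var_eq_0 by fastforce
qed

text \<open>The complex F(V) is represented by V-free vectors, with the differential of the
  resolution followed by setting V to zero. All groups are taken in one bidegree d; the homology is
  only ever asked to vanish (\<open>acyclic_at\<close>) or to admit no nonzero element killed by a
  variable (\<open>regular_at\<close>), so no quotient groups are formed.\<close>

locale resolution =
  fixes J :: "('n::finite, 'm::finite, 'k::field) bipoly set" and C :: "('n, 'm, 'k) free_complex"
  assumes bigraded: "bigraded_ideal J" and res: "bigraded_free_resolution J C"
begin

lemmas J_ideal = bigraded_ideal_hclosed(1)[OF bigraded] and J_hclosed = bigraded_ideal_hclosed(2)[OF bigraded]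

lemma aug_bipart: "j < rnk C 0 \<Longrightarrow> aug C j \<in> bipart (bdeg C 0 j)"
  and dmat: "hmatrix (rnk C i) (bdeg C i) (rnk C (Suc i)) (bdeg C (Suc i)) (dmat C i)"
  and aug_surj: "\<exists>v\<in>free_mod (rnk C 0). aug_map C v - f \<in> J"
  and exact_0: "{v \<in> free_mod (rnk C 0). aug_map C v \<in> J} = diff_map C 0 ` free_mod (rnk C (Suc 0))"
  and exact_Suc: "{v \<in> free_mod (rnk C (Suc i)). diff_map C i v = 0}
      = diff_map C (Suc i) ` free_mod (rnk C (Suc (Suc i)))"
  using res unfolding bigraded_free_resolution_iff[OF J_ideal] by blast+

definition chains :: "('n + 'm) set \<Rightarrow> nat \<Rightarrow> int \<times> int \<Rightarrow> (nat \<Rightarrow> ('n, 'm, 'k) bipoly) set" where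
  "chains V i d = {v \<in> hvec (rnk C i) (bdeg C i) d. vproj V v = v}"

definition bd :: "('n + 'm) set \<Rightarrow> nat \<Rightarrow> (nat \<Rightarrow> ('n, 'm, 'k) bipoly) \<Rightarrow> nat \<Rightarrow> ('n, 'm, 'k) bipoly" where
  "bd V i v = vproj V (diff_map C i v)"

definition cycles :: "('n + 'm) set \<Rightarrow> nat \<Rightarrow> int \<times> int \<Rightarrow> (nat \<Rightarrow> ('n, 'm, 'k) bipoly) set" where
  "cycles V i d = {z \<in> chains V i d. case i of 0 \<Rightarrow> True | Suc i' \<Rightarrow> bd V i' z = 0}"

definition boundaries :: "('n + 'm) set \<Rightarrow> nat \<Rightarrow> int \<times> int \<Rightarrow> (nat \<Rightarrow> ('n, 'm, 'k) bipoly) set" where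
  "boundaries V i d = bd V i ` chains V (Suc i) d"

definition acyclic_at :: "('n + 'm) set \<Rightarrow> nat \<Rightarrow> int \<times> int \<Rightarrow> bool" where
  "acyclic_at V i d \<longleftrightarrow> cycles V i d \<subseteq> boundaries V i d"

definition regular_at :: "('n + 'm) set \<Rightarrow> 'n + 'm \<Rightarrow> nat \<Rightarrow> int \<times> int \<Rightarrow> bool" where
  "regular_at V x i d \<longleftrightarrow> (\<forall>z\<in>cycles V i d. smul (var x) z \<in> boundaries V i (d + vdeg x) \<longrightarrow> z \<in> boundaries V i d)"

lemma diff_map_linear:
  "diff_map C i 0 = 0" "diff_map C i (v + w) = diff_map C i v + diff_map C i w"
  "diff_map C i (v - w) = diff_map C i v - diff_map C i w" "diff_map C i (smul f v) = smul f (diff_map C i v)"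
  unfolding diff_map_def by (rule mat_map_linear)+

lemma bd_linear:
  "bd V i 0 = 0" "bd V i (v + w) = bd V i v + bd V i w"
  "bd V i (v - w) = bd V i v - bd V i w" "x \<notin> V \<Longrightarrow> bd V i (smul (var x) v) = smul (var x) (bd V i v)"
  by (simp_all add: bd_def diff_map_linear vproj_linear)

lemma chains_closed:
  "0 \<in> chains V i d" "v \<in> chains V i d \<Longrightarrow> w \<in> chains V i d \<Longrightarrow> v + w \<in> chains V i d"
  "v \<in> chains V i d \<Longrightarrow> w \<in> chains V i d \<Longrightarrow> v - w \<in> chains V i d"
  "x \<notin> V \<Longrightarrow> v \<in> chains V i d \<Longrightarrow> smul (var x) v \<in> chains V i (d + vdeg x)"
  by (simp_all add: chains_def hvec_closed hvec_smul_var vproj_linear)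

lemma bd_chains: "v \<in> chains V (Suc i) d \<Longrightarrow> bd V i v \<in> chains V i d"
  unfolding chains_def bd_def diff_map_def
  by (auto intro: vproj_hvec mat_map_hvec[OF dmat] simp: vproj_vproj)

lemma chains_free_mod: "v \<in> chains V i d \<Longrightarrow> v \<in> free_mod (rnk C i)"
  by (simp add: chains_def hvec_def)

lemma vproj_chains: "v \<in> chains V i d \<Longrightarrow> V \<subseteq> W \<Longrightarrow> vproj W v \<in> chains W i d"
  by (simp add: chains_def vproj_hvec vproj_vproj)

lemma chains_mono: "v \<in> chains W i d \<Longrightarrow> V \<subseteq> W \<Longrightarrow> v \<in> chains V i d"
  unfolding chains_def using vproj_vproj(2)[of V W v] by auto

lemma vproj_bd: "V \<subseteq> W \<Longrightarrow> vproj W (bd V i v) = bd W i v"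
  by (simp add: bd_def vproj_vproj)

lemma bd_vproj: "V \<subseteq> W \<Longrightarrow> bd W i (vproj V v) = bd W i v"
  unfolding bd_def diff_map_def by (rule vproj_mat_map)

lemma bd_bd:
  assumes "v \<in> free_mod (rnk C (Suc (Suc i)))"
  shows "bd V i (bd V (Suc i) v) = 0"
proof -
  have "bd V i (bd V (Suc i) v) = bd V i (diff_map C (Suc i) v)"
    unfolding bd_def[of V "Suc i"] by (rule bd_vproj) simp
  moreover have "diff_map C i (diff_map C (Suc i) v) = 0" using assms exact_Suc[of i] by blast
  ultimately show ?thesis by (simp add: bd_def vproj_linear)
qed

lemma chains_split_var:
  assumes "v \<in> chains V i (d + vdeg x)" "vproj (insert x V) v = 0"
  obtains w where "w \<in> chains V i d" "v = smul (var x) w"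
proof -
  have v: "v \<in> hvec (rnk C i) (bdeg C i) (d + vdeg x)" "vproj V v = v"
    using assms(1) by (auto simp: chains_def)
  have "vproj {x} (vproj V v) = vproj (insert x V) v"
    by (simp add: vproj_def proj_proj)
  then have "vproj {x} v = 0" using assms(2) v(2) by simp
  from hvec_split_var[OF v(1) this] obtain w where
    w: "w \<in> hvec (rnk C i) (bdeg C i) d" "v = smul (var x) w" "\<And>V. vproj V v = v \<Longrightarrow> vproj V w = w"
    by blast
  from w(1) w(3)[OF v(2)] have "w \<in> chains V i d" by (simp add: chains_def)
  then show ?thesis using w(2) by (rule that)
qed

lemma cycles_chains: "z \<in> cycles V i d \<Longrightarrow> z \<in> chains V i d"
  by (simp add: cycles_def)

lemma boundaries_cycles: "boundaries V i d \<subseteq> cycles V i d"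
  by (auto simp: boundaries_def cycles_def bd_chains bd_bd chains_free_mod split: nat.split)

lemma cycles_diff: "z \<in> cycles V i d \<Longrightarrow> w \<in> cycles V i d \<Longrightarrow> z - w \<in> cycles V i d"
  by (auto simp: cycles_def chains_closed bd_linear split: nat.splits)

lemma cycles_vproj:
  assumes "z \<in> cycles V i d" "V \<subseteq> W" shows "vproj W z \<in> cycles W i d"
proof -
  have "bd W i' (vproj W z) = 0" if "bd V i' z = 0" for i'
    using vproj_bd[OF assms(2), of i' z] that bd_vproj[of W W i' z] by (simp add: vproj_linear)
  moreover have "vproj W z \<in> chains W i d" using cycles_chains[OF assms(1)] assms(2) by (rule vproj_chains)
  ultimately show ?thesis using assms(1) by (cases i) (auto simp: cycles_def)
qed

lemma cycles_smul_var:
  assumes "x \<notin> V" "w \<in> chains V i d"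
  shows "smul (var x) w \<in> cycles V i (d + vdeg x) \<longleftrightarrow> w \<in> cycles V i d"
proof (cases i)
  case (Suc i')
  have "smul (var x) (bd V i' w) = 0 \<longleftrightarrow> bd V i' w = 0"
    using smul_var_eq_0 by (auto simp: smul_def fun_eq_iff)
  then show ?thesis
    using assms unfolding cycles_def Suc by (simp add: chains_closed bd_linear)
qed (use assms in \<open>simp add: cycles_def chains_closed\<close>)

text \<open>The map from H_0(V) to H_0(V + x) is onto.\<close>

lemma acyclic_insert_0:
  assumes "acyclic_at V 0 d" shows "acyclic_at (insert x V) 0 d"
  unfolding acyclic_at_def
proof
  let ?W = "insert x V"
  have sub: "V \<subseteq> ?W" by blast
  fix z assume z: "z \<in> cycles ?W 0 d"
  then have zW: "z \<in> chains ?W 0 d" by (rule cycles_chains)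
  then have "z \<in> cycles V 0 d" by (auto simp: cycles_def intro: chains_mono)
  then obtain t where t: "t \<in> chains V 1 d" "z = bd V 0 t"
    using assms by (auto simp: acyclic_at_def boundaries_def)
  have "z = vproj ?W z" using zW by (simp add: chains_def)
  also have "\<dots> = bd ?W 0 (vproj ?W t)" by (simp add: t(2) vproj_bd bd_vproj sub)
  finally show "z \<in> boundaries ?W 0 d"
    using vproj_chains[OF t(1) sub] by (auto simp: boundaries_def)
qed

text \<open>In the long exact sequence H_{i+1}(V + x) lies between H_{i+1}(V) and the kernel of x on
  H_i(V).\<close>

lemma acyclic_insert_Suc:
  assumes x: "x \<notin> V" and ac: "acyclic_at V (Suc i) (d + vdeg x)" and reg: "regular_at V x i d"
  shows "acyclic_at (insert x V) (Suc i) (d + vdeg x)"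
  unfolding acyclic_at_def
proof
  let ?W = "insert x V" and ?d = "d + vdeg x"
  have sub: "V \<subseteq> ?W" by blast
  fix z assume z: "z \<in> cycles ?W (Suc i) ?d"
  then have zW: "z \<in> chains ?W (Suc i) ?d" "bd ?W i z = 0" by (auto simp: cycles_def)
  then have zV: "z \<in> chains V (Suc i) ?d" using chains_mono sub by blast
  have "vproj ?W (bd V i z) = 0" using zW(2) by (simp add: vproj_bd sub)
  then obtain w where w: "w \<in> chains V i d" "bd V i z = smul (var x) w"
    using chains_split_var[OF bd_chains[OF zV]] by blast
  have b: "smul (var x) w \<in> boundaries V i ?d" unfolding boundaries_def using w(2) zV by force
  then have "w \<in> cycles V i d" using boundaries_cycles cycles_smul_var[OF x w(1)] by blast
  then have "w \<in> boundaries V i d" using reg b by (simp add: regular_at_def)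
  then obtain w' where w': "w' \<in> chains V (Suc i) d" "w = bd V i w'" by (auto simp: boundaries_def)
  have "z - smul (var x) w' \<in> cycles V (Suc i) ?d"
    using zV w w' x by (simp add: cycles_def chains_closed bd_linear)
  then obtain t where t: "t \<in> chains V (Suc (Suc i)) ?d" "z - smul (var x) w' = bd V (Suc i) t"
    using ac by (auto simp: acyclic_at_def boundaries_def)
  have "z = vproj ?W (z - smul (var x) w')"
    using zW(1) by (simp add: chains_def vproj_linear(3) vproj_smul_var)
  also have "\<dots> = bd ?W (Suc i) (vproj ?W t)" by (simp add: t(2) vproj_bd bd_vproj sub)
  finally show "z \<in> boundaries ?W (Suc i) ?d"
    using vproj_chains[OF t(1) sub] unfolding boundaries_def by blast
qed

text \<open>The connecting map sends H_{i+1}(V + x) onto the kernel of x on H_i(V).\<close>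

lemma not_acyclic_insert_Suc:
  assumes x: "x \<notin> V" and nreg: "\<not> regular_at V x i d"
  shows "\<not> acyclic_at (insert x V) (Suc i) (d + vdeg x)"
proof
  let ?W = "insert x V" and ?d = "d + vdeg x"
  have sub: "V \<subseteq> ?W" by blast
  assume ac: "acyclic_at ?W (Suc i) ?d"
  obtain z where z: "z \<in> cycles V i d" "smul (var x) z \<in> boundaries V i ?d" "z \<notin> boundaries V i d"
    using nreg by (auto simp: regular_at_def)
  obtain t where t: "t \<in> chains V (Suc i) ?d" "smul (var x) z = bd V i t"
    using z(2) by (auto simp: boundaries_def)
  have "bd ?W i (vproj ?W t) = vproj ?W (smul (var x) z)"
    by (simp add: bd_vproj vproj_bd sub t(2))
  also have "\<dots> = 0" by (simp add: vproj_smul_var)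
  finally have "vproj ?W t \<in> cycles ?W (Suc i) ?d"
    using vproj_chains[OF t(1) sub] by (simp add: cycles_def)
  then obtain s where s: "s \<in> chains ?W (Suc (Suc i)) ?d" "vproj ?W t = bd ?W (Suc i) s"
    using ac by (auto simp: acyclic_at_def boundaries_def)
  have sV: "s \<in> chains V (Suc (Suc i)) ?d" using s(1) chains_mono sub by blast
  have "vproj ?W (t - bd V (Suc i) s) = 0" by (simp add: vproj_linear vproj_bd sub s(2))
  then obtain w where w: "w \<in> chains V (Suc i) d" "t - bd V (Suc i) s = smul (var x) w"
    using chains_split_var[OF chains_closed(3)[OF t(1) bd_chains[OF sV]]] by blast
  have "smul (var x) z = bd V i (t - bd V (Suc i) s)"
    using bd_bd[OF chains_free_mod[OF sV]] by (simp add: bd_linear t(2))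
  also have "\<dots> = smul (var x) (bd V i w)" by (simp add: w(2) bd_linear x)
  finally have "z = bd V i w" by (rule smul_var_cancel)
  then show False using z(3) w(1) by (auto simp: boundaries_def)
qed

text \<open>The kernel of the map from H_i(V) to H_i(V + x) is the image of x, which is zero in a
  degree where its source vanishes.\<close>

lemma not_acyclic_insert:
  assumes x: "x \<notin> V" and nac: "\<not> acyclic_at V i (d + vdeg x)" and ac: "acyclic_at V i d"
  shows "\<not> acyclic_at (insert x V) i (d + vdeg x)"
proof
  let ?W = "insert x V" and ?d = "d + vdeg x"
  have sub: "V \<subseteq> ?W" by blast
  assume acW: "acyclic_at ?W i ?d"
  obtain z where z: "z \<in> cycles V i ?d" "z \<notin> boundaries V i ?d" using nac by (auto simp: acyclic_at_def)
  have "vproj ?W z \<in> boundaries ?W i ?d" using acW cycles_vproj[OF z(1) sub] by (auto simp: acyclic_at_def)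
  then obtain s where s: "s \<in> chains ?W (Suc i) ?d" "vproj ?W z = bd ?W i s" by (auto simp: boundaries_def)
  have sV: "s \<in> chains V (Suc i) ?d" using s(1) chains_mono sub by blast
  then have bs: "bd V i s \<in> cycles V i ?d"
    using boundaries_cycles unfolding boundaries_def by blast
  have "vproj ?W (z - bd V i s) = 0" by (simp add: vproj_linear vproj_bd sub s(2))
  then obtain w where w: "w \<in> chains V i d" "z - bd V i s = smul (var x) w"
    using chains_split_var[OF cycles_chains[OF cycles_diff[OF z(1) bs]]] by blast
  have "w \<in> cycles V i d" using cycles_diff[OF z(1) bs] cycles_smul_var[OF x w(1)] w(2) by simp
  then obtain u where u: "u \<in> chains V (Suc i) d" "w = bd V i u"
    using ac by (auto simp: acyclic_at_def boundaries_def)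
  have "z = bd V i s + smul (var x) w" using w(2) by (metis add.commute diff_add_cancel)
  also have "\<dots> = bd V i (s + smul (var x) u)" by (simp add: bd_linear u(2) x)
  finally show False using z(2) chains_closed(2)[OF sV chains_closed(4)[OF x u(1)]] by (auto simp: boundaries_def)
qed

text \<open>Exactness of the resolution, read in a single degree.\<close>

lemma acyclic_empty: "acyclic_at {} (Suc i) d"
  unfolding acyclic_at_def
proof
  fix z assume z: "z \<in> cycles {} (Suc i) d"
  then have zc: "z \<in> chains {} (Suc i) d" "diff_map C i z = 0" by (auto simp: cycles_def bd_def)
  then obtain w where w: "w \<in> free_mod (rnk C (Suc (Suc i)))" "z = diff_map C (Suc i) w"
    using exact_Suc[of i] chains_free_mod by blast
  have "z = vcomp (bdeg C (Suc i)) d z" using zc(1) by (simp add: chains_def vcomp_id)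
  also have "\<dots> = diff_map C (Suc i) (vcomp (bdeg C (Suc (Suc i))) d w)"
    unfolding w(2) diff_map_def by (rule mat_map_vcomp[OF dmat, symmetric])
  finally show "z \<in> boundaries {} (Suc i) d"
    using vcomp_hvec[OF w(1)] by (auto simp: boundaries_def bd_def chains_def)
qed

lemma aug_map_linear:
  "aug_map C (v + w) = aug_map C v + aug_map C w" "aug_map C (v - w) = aug_map C v - aug_map C w"
  "aug_map C (smul f v) = f * aug_map C v" "aug_map C 0 = 0"
  by (simp_all add: aug_map_def smul_def algebra_simps sum.distrib sum_subtractf sum_distrib_left)

lemma aug_map_bipart: "v \<in> hvec (rnk C 0) (bdeg C 0) d \<Longrightarrow> aug_map C v \<in> bipart d"
  unfolding aug_map_def
  by (rule bipart_sum, rule bipart_mult'[OF aug_bipart]) (auto simp: hvec_def)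

lemma hcomp_aug_map: "hcomp d (aug_map C v) = aug_map C (vcomp (bdeg C 0) d v)"
  unfolding aug_map_def vcomp_def hcomp_sum
  by (rule sum.cong) (auto simp: hcomp_mult_left[OF aug_bipart])

lemma proj_aug_map: "vproj V v = 0 \<Longrightarrow> proj V (aug_map C v) = 0"
  by (auto simp: aug_map_def proj_sum proj_mult vproj_def fun_eq_iff)

text \<open>This identifies H_0(V) with S/(J + (V)): the augmentation maps exactly the boundaries
  into the ideal. For the less obvious direction, each element of J + (V) is, modulo J, the image of
  a vector that vanishes when V is set to zero; such vectors can be subtracted from z without
  changing its class in F(V), and what remains is a boundary of the resolution.\<close>

lemma boundaries_0_iff:
  assumes z: "z \<in> chains V 0 d"
  shows "z \<in> boundaries V 0 d \<longleftrightarrow> aug_map C z \<in> plus_vars J V"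
proof
  assume "z \<in> boundaries V 0 d"
  then obtain w where w: "w \<in> chains V 1 d" "z = bd V 0 w" by (auto simp: boundaries_def)
  have "aug_map C (diff_map C 0 w) \<in> J" using exact_0 chains_free_mod[OF w(1)] by auto
  then have "aug_map C (diff_map C 0 w) \<in> plus_vars J V"
    unfolding plus_vars_def by (intro ideal_gen_superset) simp
  moreover have "vproj V (diff_map C 0 w - z) = 0"
    by (simp add: w(2) bd_def vproj_linear vproj_vproj)
  then have "aug_map C (diff_map C 0 w) - aug_map C z \<in> plus_vars J V"
    unfolding aug_map_linear(2)[symmetric] by (intro proj_0_in_plus_vars proj_aug_map)
  ultimately show "aug_map C z \<in> plus_vars J V"
    using ideal_diff_left_iff[OF plus_vars_ideal] by blast
next
  assume az: "aug_map C z \<in> plus_vars J V"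
  \<comment> \<open>The elements that lift, modulo J, to vectors vanishing at V = 0.\<close>
  let ?I = "{h. \<exists>u\<in>free_mod (rnk C 0). vproj V u = 0 \<and> aug_map C u - h \<in> J}"
  have "is_ideal ?I"
    unfolding is_ideal_iff
  proof (intro conjI ballI allI)
    show "0 \<in> ?I" using ideal_closed(1)[OF J_ideal]
      by (auto intro!: bexI[of _ 0] simp: free_mod_closed vproj_linear aug_map_linear)
    fix a assume "a \<in> ?I"
    then obtain u where u: "u \<in> free_mod (rnk C 0)" "vproj V u = 0" "aug_map C u - a \<in> J" by blast
    show "c * a \<in> ?I" for c
    proof -
      have "smul (proj V c) 0 = (0 :: nat \<Rightarrow> ('n, 'm, 'k) bipoly)" by (simp add: smul_def fun_eq_iff)
      then show ?thesis
        using u ideal_closed(3)[OF J_ideal u(3), of c]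
        by (auto intro!: bexI[of _ "smul c u"] simp: free_mod_closed vproj_linear aug_map_linear algebra_simps)
    qed
    fix b assume "b \<in> ?I"
    then obtain w where w: "w \<in> free_mod (rnk C 0)" "vproj V w = 0" "aug_map C w - b \<in> J" by blast
    show "a + b \<in> ?I"
      using u w ideal_closed(2)[OF J_ideal u(3) w(3)]
      by (auto intro!: bexI[of _ "u + w"] simp: free_mod_closed vproj_linear aug_map_linear algebra_simps)
  qed
  moreover have "J \<union> var ` V \<subseteq> ?I"
  proof
    fix h assume "h \<in> J \<union> var ` V"
    then show "h \<in> ?I"
    proof
      assume "h \<in> J"
      then have "0 - h \<in> J" by (intro ideal_closed(5)[OF J_ideal] ideal_closed(1)[OF J_ideal])
      then show ?thesis by (auto intro!: bexI[of _ 0] simp: free_mod_closed vproj_linear aug_map_linear)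
    next
      assume "h \<in> var ` V"
      then obtain x where x: "x \<in> V" "h = var x" by blast
      obtain u where u: "u \<in> free_mod (rnk C 0)" "aug_map C u - 1 \<in> J" using aug_surj by blast
      have "var x * (aug_map C u - 1) \<in> J" by (rule ideal_closed(3)[OF J_ideal u(2)])
      then show ?thesis using u(1) x
        by (auto intro!: bexI[of _ "smul (var x) u"]
            simp: free_mod_closed vproj_smul_var aug_map_linear algebra_simps)
    qed
  qed
  ultimately have "plus_vars J V \<subseteq> ?I" unfolding plus_vars_def by (rule ideal_gen_subset[rotated])
  then obtain u where u: "u \<in> free_mod (rnk C 0)" "vproj V u = 0" "aug_map C u - aug_map C z \<in> J"
    using az by blast
  have "aug_map C (u - z) \<in> J" using u(3) by (simp only: aug_map_linear)
  moreover have "u - z \<in> free_mod (rnk C 0)" using u(1) chains_free_mod[OF z] by (rule free_mod_closed)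
  ultimately obtain w where w: "w \<in> free_mod (rnk C 1)" "u - z = diff_map C 0 w"
    using exact_0 by auto
  have "0 - w \<in> free_mod (rnk C 1)" using free_mod_closed(1) w(1) by (rule free_mod_closed(3))
  \<comment> \<open>The sign turns u - z into z - u; as z is V-free and homogeneous, the preimage may be made so.\<close>
  let ?w = "vcomp (bdeg C 1) d (vproj V (0 - w))"
  have "?w \<in> chains V 1 d"
    using vcomp_hvec[OF vproj_free_mod[OF \<open>0 - w \<in> _\<close>]]
    by (simp only: chains_def vproj_vcomp vproj_vproj order_refl mem_Collect_eq simp_thms)
  moreover have "bd V 0 ?w = z"
  proof -
    have "bd V 0 ?w = vproj V (vcomp (bdeg C 0) d (diff_map C 0 (vproj V (0 - w))))"
      unfolding bd_def diff_map_def using mat_map_vcomp[OF dmat, of 0 d] by simp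
    also have "\<dots> = vcomp (bdeg C 0) d (bd V 0 (vproj V (0 - w)))"
      by (simp only: vproj_vcomp bd_def)
    also have "bd V 0 (vproj V (0 - w)) = bd V 0 (0 - w)" by (rule bd_vproj) simp
    also have "\<dots> = vproj V (z - u)"
      unfolding bd_def diff_map_linear w(2)[symmetric] by simp
    also have "\<dots> = z" using z u(2) by (simp add: vproj_linear chains_def)
    also have "vcomp (bdeg C 0) d z = z" using z unfolding chains_def by (blast intro: vcomp_id)
    finally show ?thesis .
  qed
  ultimately show "z \<in> boundaries V 0 d" unfolding boundaries_def by (metis One_nat_def image_eqI)
qed

text \<open>The other half of the identification of H_0(V) with S/(J + (V)): surjectivity in each
  degree.\<close>

lemma aug_lift:
  fixes f :: "('n, 'm, 'k) bipoly"
  assumes "f \<in> bipart d"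
  obtains z where "z \<in> chains V 0 d" "aug_map C z - f \<in> plus_vars J V"
proof -
  obtain v where v: "v \<in> free_mod (rnk C 0)" "aug_map C v - f \<in> J" using aug_surj by blast
  let ?v = "vcomp (bdeg C 0) d v"
  have "hcomp d (aug_map C v - f) \<in> J" using J_hclosed v(2) unfolding hclosed_def by blast
  then have "aug_map C ?v - f \<in> J" using assms by (simp add: hcomp_diff hcomp_id hcomp_aug_map)
  then have *: "aug_map C ?v - f \<in> plus_vars J V" unfolding plus_vars_def by (intro ideal_gen_superset) simp
  have "vproj V (vproj V ?v - ?v) = 0" by (simp add: vproj_linear vproj_vproj)
  then have "aug_map C (vproj V ?v) - aug_map C ?v \<in> plus_vars J V"
    unfolding aug_map_linear(2)[symmetric] by (intro proj_0_in_plus_vars proj_aug_map)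
  from ideal_closed(2)[OF plus_vars_ideal this *]
  have "aug_map C (vproj V ?v) - f \<in> plus_vars J V" by simp
  moreover have "vproj V ?v \<in> chains V 0 d"
    using vcomp_hvec[OF v(1)] by (simp add: chains_def vproj_hvec vproj_vproj)
  ultimately show ?thesis using that by blast
qed

lemma acyclic_at_0_iff: "acyclic_at V 0 d \<longleftrightarrow> bipart d \<subseteq> plus_vars J V"
proof
  assume ac: "acyclic_at V 0 d"
  show "bipart d \<subseteq> plus_vars J V"
  proof
    fix f :: "('n, 'm, 'k) bipoly" assume "f \<in> bipart d"
    then obtain z where z: "z \<in> chains V 0 d" "aug_map C z - f \<in> plus_vars J V" by (rule aug_lift)
    then have "z \<in> boundaries V 0 d" using ac by (auto simp: acyclic_at_def cycles_def)
    then show "f \<in> plus_vars J V"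
      using boundaries_0_iff[OF z(1)] ideal_diff_left_iff[OF plus_vars_ideal z(2)] by blast
  qed
next
  assume sub: "bipart d \<subseteq> plus_vars J V"
  show "acyclic_at V 0 d"
    unfolding acyclic_at_def
  proof
    fix z assume "z \<in> cycles V 0 d"
    then have z: "z \<in> chains V 0 d" by (rule cycles_chains)
    then have "aug_map C z \<in> bipart d" unfolding chains_def by (blast intro: aug_map_bipart)
    then show "z \<in> boundaries V 0 d" using sub boundaries_0_iff[OF z] by blast
  qed
qed

lemma regular_at_0_iff:
  assumes x: "x \<notin> V"
  shows "regular_at V x 0 d \<longleftrightarrow> (\<forall>f\<in>bipart d. var x * f \<in> plus_vars J V \<longrightarrow> f \<in> plus_vars J V)"
proof
  assume reg: "regular_at V x 0 d"
  show "\<forall>f\<in>bipart d. var x * f \<in> plus_vars J V \<longrightarrow> f \<in> plus_vars J V"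
  proof (intro ballI impI)
    fix f :: "('n, 'm, 'k) bipoly" assume f: "f \<in> bipart d" "var x * f \<in> plus_vars J V"
    obtain z where z: "z \<in> chains V 0 d" "aug_map C z - f \<in> plus_vars J V" using f(1) by (rule aug_lift)
    have "var x * aug_map C z - var x * f \<in> plus_vars J V"
      using ideal_closed(3)[OF plus_vars_ideal z(2), of "var x"] by (simp add: algebra_simps)
    then have "var x * aug_map C z \<in> plus_vars J V"
      using f(2) ideal_diff_left_iff[OF plus_vars_ideal] by blast
    then have "smul (var x) z \<in> boundaries V 0 (d + vdeg x)"
      using boundaries_0_iff[OF chains_closed(4)[OF x z(1)]] by (simp add: aug_map_linear)
    then have "z \<in> boundaries V 0 d" using reg z(1) by (simp add: regular_at_def cycles_def)
    then show "f \<in> plus_vars J V"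
      using boundaries_0_iff[OF z(1)] ideal_diff_left_iff[OF plus_vars_ideal z(2)] by blast
  qed
next
  assume *: "\<forall>f\<in>bipart d. var x * f \<in> plus_vars J V \<longrightarrow> f \<in> plus_vars J V"
  show "regular_at V x 0 d"
    unfolding regular_at_def
  proof (intro ballI impI)
    fix z assume z: "z \<in> cycles V 0 d" "smul (var x) z \<in> boundaries V 0 (d + vdeg x)"
    note zc = cycles_chains[OF z(1)]
    have "var x * aug_map C z \<in> plus_vars J V"
      using z(2) boundaries_0_iff[OF chains_closed(4)[OF x zc]] by (simp add: aug_map_linear)
    moreover have "aug_map C z \<in> bipart d" using zc aug_map_bipart by (auto simp: chains_def)
    ultimately show "z \<in> boundaries V 0 d" using * boundaries_0_iff[OF zc] by blast
  qed
qed

end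

section \<open>Betti numbers as homology modulo all variables\<close>

text \<open>Strict monotonicity of the dimension relies on finite bases, which the ambient space
  \<open>free_mod r\<close> provides.\<close>

lemma dim_less_of_psubset:
  fixes B Z :: "(nat \<Rightarrow> 'k::field) set"
  assumes "module.subspace vscale B" "B \<subseteq> Z" "B \<noteq> Z" "Z \<subseteq> free_mod r"
  shows "vector_space.dim vscale B < vector_space.dim vscale Z"
proof -
  interpret vector_space "vscale :: 'k \<Rightarrow> _" by (rule vector_space_vscale)
  define unit :: "nat \<Rightarrow> nat \<Rightarrow> 'k" where "unit k = (\<lambda>j. if j = k then 1 else 0)" for k
  have free_span: "free_mod r \<subseteq> span (unit ` {..<r})"
  proof
    fix v :: "nat \<Rightarrow> 'k" assume v: "v \<in> free_mod r"
    have "(\<Sum>k<r. vscale (v k) (unit k)) j = v j" for j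
    proof -
      have "(\<Sum>k<r. vscale (v k) (unit k)) j = (\<Sum>k<r. v k * unit k j)"
        by (induction r) (auto simp: vscale_def)
      also have "\<dots> = v j"
        using v by (cases "j < r") (auto simp: unit_def free_mod_def if_distrib cong: if_cong)
      finally show ?thesis .
    qed
    then have "v = (\<Sum>k<r. vscale (v k) (unit k))" by (simp add: fun_eq_iff)
    also have "\<dots> \<in> span (unit ` {..<r})" by (intro span_sum span_scale span_base) auto
    finally show "v \<in> span (unit ` {..<r})" .
  qed
  obtain c where c: "c \<subseteq> Z" "independent c" "Z \<subseteq> span c" "card c = dim Z" by (rule basis_exists)
  have fin_c: "finite c"
    using independent_span_bound[OF _ c(2), of "unit ` {..<r}"] c(1) assms(4) free_span by auto
  obtain b where b: "b \<subseteq> B" "independent b" "B \<subseteq> span b" "card b = dim B" by (rule basis_exists)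
  have span_b: "span b = B" using b assms(1) by (meson span_minimal subset_antisym)
  obtain z where z: "z \<in> Z" "z \<notin> B" using assms(2,3) by blast
  then have "independent (insert z b)" using b(2) span_b by (simp add: independent_insert)
  moreover have "insert z b \<subseteq> span c" using z(1) b(1) assms(2) c(3) by blast
  ultimately have card: "finite (insert z b) \<and> card (insert z b) \<le> card c"
    by (rule independent_span_bound[OF fin_c])
  moreover have "z \<notin> b" using z(2) b(1) by blast
  ultimately have "Suc (card b) \<le> card c"
    using card card_insert_disjoint[of b z] by (metis finite_insert)
  then show ?thesis using b(4) c(4) by simp
qed

context resolution
begin

text \<open>Vectors free of all variables have constant entries, which identifies F modulo all
  variables with the tensor product of F and K.\<close>

definition const_vec :: "(nat \<Rightarrow> 'k) \<Rightarrow> nat \<Rightarrow> ('n, 'm, 'k) bipoly" where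
  "const_vec c = (\<lambda>j. Poly_Mapping.single 0 (c j))"

lemma inj_const_vec: "inj const_vec"
  by (rule injI) (auto simp: const_vec_def fun_eq_iff dest: injD[OF inj_single])

lemma const_vec_0: "const_vec c = 0 \<longleftrightarrow> c = 0"
  using inj_const_vec[THEN injD, of c 0] by (auto simp: const_vec_def fun_eq_iff)

lemma const_vec_tensor_part: "const_vec ` tensor_part C i d = chains UNIV i d"
proof (intro equalityI subsetI)
  fix v assume "v \<in> const_vec ` tensor_part C i d"
  then show "v \<in> chains UNIV i d"
    by (auto simp: tensor_part_def chains_def hvec_def free_mod_def const_vec_def vproj_def proj_UNIV bipart_iff
        split: if_splits)
next
  fix v assume v: "v \<in> chains UNIV i d"
  let ?c = "\<lambda>j. Poly_Mapping.lookup (v j) 0"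
  have "v = const_vec ?c" using v by (auto simp: chains_def vproj_def proj_UNIV const_vec_def fun_eq_iff)
  moreover have "bdeg C i j = d" if "?c j \<noteq> 0" for j
  proof -
    have "0 \<in> Poly_Mapping.keys (v j)" using that by (simp add: in_keys_iff)
    then have "bideg (0 :: 'n + 'm \<Rightarrow>\<^sub>0 nat) = d - bdeg C i j"
      using v unfolding chains_def hvec_def bipart_iff by blast
    then show ?thesis by simp
  qed
  then have "?c \<in> tensor_part C i d"
    using chains_free_mod[OF v] by (simp add: free_mod_def tensor_part_def)
  ultimately show "v \<in> const_vec ` tensor_part C i d" by (rule image_eqI)
qed

lemma bd_const_vec: "bd UNIV i (const_vec c) = const_vec (tensor_diff C i c)"
proof -
  have "Poly_Mapping.lookup (f * Poly_Mapping.single 0 a) 0 = Poly_Mapping.lookup f 0 * a"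
    for f :: "('n, 'm, 'k) bipoly" and a
    using lookup_single_mult_shift[of 0 a f 0] by (simp add: mult.commute)
  then show ?thesis
    by (auto simp: bd_def vproj_def proj_UNIV const_vec_def diff_map_def tensor_diff_def mat_map_def
        lookup_sum fun_eq_iff)
qed

lemma const_vec_tensor_cycles: "const_vec ` tensor_cycles C i d = cycles UNIV i d"
  unfolding cycles_def tensor_cycles_def const_vec_tensor_part[symmetric]
  by (cases i) (auto simp: bd_const_vec const_vec_0)

lemma const_vec_tensor_boundaries: "const_vec ` tensor_boundaries C i d = boundaries UNIV i d"
  unfolding boundaries_def tensor_boundaries_def const_vec_tensor_part[symmetric]
  by (simp add: image_image bd_const_vec)

lemma tensor_boundaries_cycles: "tensor_boundaries C i d \<subseteq> tensor_cycles C i d"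
  using boundaries_cycles[of UNIV i d]
  unfolding const_vec_tensor_cycles[symmetric] const_vec_tensor_boundaries[symmetric]
  by (simp add: inj_image_subset_iff[OF inj_const_vec])

lemma acyclic_at_UNIV_iff: "acyclic_at UNIV i d \<longleftrightarrow> tensor_cycles C i d \<subseteq> tensor_boundaries C i d"
  unfolding acyclic_at_def const_vec_tensor_cycles[symmetric] const_vec_tensor_boundaries[symmetric]
  by (simp add: inj_image_subset_iff[OF inj_const_vec])

lemma tensor_boundaries_subspace: "module.subspace vscale (tensor_boundaries C i d)"
proof -
  interpret vector_space "vscale :: 'k \<Rightarrow> _" by (rule vector_space_vscale)
  have scale: "vscale c (tensor_diff C i v) = tensor_diff C i (vscale c v)" for c v
    by (auto simp: vscale_def tensor_diff_def mat_map_def sum_distrib_left algebra_simps)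
  have add: "tensor_diff C i v + tensor_diff C i w = tensor_diff C i (v + w)" for v w
    unfolding tensor_diff_def by (simp add: mat_map_linear)
  have zero: "0 = tensor_diff C i 0" unfolding tensor_diff_def by (simp add: mat_map_linear)
  have "v + w \<in> tensor_part C (Suc i) d" if "v \<in> tensor_part C (Suc i) d" "w \<in> tensor_part C (Suc i) d" for v w
    using that by (auto simp: tensor_part_def free_mod_def) (metis add.right_neutral)
  moreover have "vscale c v \<in> tensor_part C (Suc i) d" if "v \<in> tensor_part C (Suc i) d" for c v
    using that by (auto simp: tensor_part_def free_mod_def vscale_def)
  moreover have "0 \<in> tensor_part C (Suc i) d" by (auto simp: tensor_part_def free_mod_def)
  ultimately show ?thesis
    unfolding subspace_def tensor_boundaries_def
    by (auto simp only: scale add) (subst zero, rule imageI)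
qed

lemma dim_quotient_nonzero_iff:
  "vector_space.dim vscale (tensor_cycles C i d) - vector_space.dim vscale (tensor_boundaries C i d) \<noteq> 0
    \<longleftrightarrow> \<not> acyclic_at UNIV i d"
proof (cases "acyclic_at UNIV i d")
  case True
  then have "tensor_cycles C i d = tensor_boundaries C i d"
    using tensor_boundaries_cycles acyclic_at_UNIV_iff by blast
  with True show ?thesis by simp
next
  case False
  have "vector_space.dim vscale (tensor_boundaries C i d) < vector_space.dim vscale (tensor_cycles C i d)"
  proof (rule dim_less_of_psubset[OF tensor_boundaries_subspace tensor_boundaries_cycles])
    show "tensor_boundaries C i d \<noteq> tensor_cycles C i d" using False acyclic_at_UNIV_iff by blast
    show "tensor_cycles C i d \<subseteq> free_mod (rnk C i)" by (auto simp: tensor_cycles_def tensor_part_def)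
  qed
  with False show ?thesis by simp
qed

end

section \<open>Annihilators in quotients\<close>

text \<open>The class of 0 is always among the annihilating classes, so nonvanishing means that
  there is another one.\<close>

lemma ann_nonzero_iff:
  assumes I: "is_ideal I" and P: "0 \<in> P a"
  shows "ann_nonzero P I f a \<longleftrightarrow> (\<exists>g\<in>P a. f * g \<in> I \<and> g \<notin> I)"
proof -
  have "residue_class I 0 \<in> ann_part P I f a"
    using P by (force simp: ann_part_def)
  then have "ann_nonzero P I f a \<longleftrightarrow> (\<exists>r\<in>ann_part P I f a. r \<noteq> residue_class I 0)"
    unfolding ann_nonzero_def by blast
  also have "\<dots> \<longleftrightarrow> (\<exists>g\<in>P a. residue_class I (f * g) = residue_class I 0 \<and> residue_class I g \<noteq> residue_class I 0)"
    unfolding ann_part_def by blast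
  finally show ?thesis by (simp add: residue_class_eq_iff[OF I])
qed

lemma bideg_eq_0_iff: "bideg u = 0 \<longleftrightarrow> u = 0"
proof
  assume "bideg u = 0"
  then have "(\<Sum>i\<in>UNIV. int (Poly_Mapping.lookup u (Inl i))) = 0"
    "(\<Sum>j\<in>UNIV. int (Poly_Mapping.lookup u (Inr j))) = 0"
    by (auto simp: bideg_def xdeg_def ydeg_def zero_prod_def)
  then have *: "Poly_Mapping.lookup u (Inl i) = 0" "Poly_Mapping.lookup u (Inr j) = 0" for i j
    by (auto simp: sum_nonneg_eq_0_iff)
  show "u = 0"
  proof (rule poly_mapping_eqI)
    fix x show "Poly_Mapping.lookup u x = Poly_Mapping.lookup 0 x" using * by (cases x) auto
  qed
qed simp

text \<open>Otherwise J contains an element with constant term 1, whose component of degree 0 is 1,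
  contrary to J being proper.\<close>

lemma one_notin_plus_vars:
  fixes J :: "('n::finite, 'm::finite, 'k::field) bipoly set"
  assumes J: "bigraded_ideal J" "J \<noteq> UNIV"
  shows "1 \<notin> plus_vars J V"
proof
  note ideal = bigraded_ideal_hclosed(1)[OF J(1)]
  assume "1 \<in> plus_vars J V"
  let ?I = "{f. \<exists>j\<in>J. proj V (f - j) = 0}"
  have "is_ideal ?I"
    unfolding is_ideal_iff
  proof (intro conjI ballI allI)
    show "0 \<in> ?I" using ideal_closed(1)[OF ideal] by (auto intro!: bexI[of _ 0])
    fix a assume "a \<in> ?I"
    then obtain j where j: "j \<in> J" "proj V (a - j) = 0" by blast
    have "proj V (c * (a - j)) = 0" for c by (simp only: proj_mult j(2) mult_zero_right)
    then show "c * a \<in> ?I" for c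
      using ideal_closed(3)[OF ideal j(1), of c] unfolding right_diff_distrib by blast
    fix b assume "b \<in> ?I"
    then obtain l where l: "l \<in> J" "proj V (b - l) = 0" by blast
    then show "a + b \<in> ?I" using j ideal_closed(2)[OF ideal j(1) l(1)]
      by (auto intro!: bexI[of _ "j + l"] simp: proj_diff proj_add)
  qed
  moreover have "J \<union> var ` V \<subseteq> ?I"
    using ideal_closed(1)[OF ideal] by (auto intro: bexI[of _ 0] bexI[rotated])
  ultimately have "plus_vars J V \<subseteq> ?I" unfolding plus_vars_def by (rule ideal_gen_subset[rotated])
  then obtain j where j: "j \<in> J" "proj V (1 - j) = 0" using \<open>1 \<in> _\<close> by blast
  have "Poly_Mapping.lookup (proj V (1 - j)) 0 = 0" using j(2) by simp
  then have "Poly_Mapping.lookup j 0 = 1" by (simp add: proj_def lookup_restr lookup_minus)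
  then have "hcomp 0 j = 1"
    by (intro poly_mapping_eqI) (auto simp: hcomp_def lookup_restr bideg_eq_0_iff lookup_one when_def)
  then have "1 \<in> J" using bigraded_ideal_hclosed(2)[OF J(1)] j(1) unfolding hclosed_def by metis
  then have "f \<in> J" for f using ideal_closed(3)[OF ideal, of 1 f] by simp
  then show False using J(2) by blast
qed

section \<open>Regularity in one of the two degrees\<close>

text \<open>The variables \<open>e i\<close> form the almost regular sequence, and the degree
  \<open>\<alpha>\<close> counts them and ignores all other variables. The x-degree and the y-degree
  are the two instances.\<close>

locale regularity_direction = resolution J C
  for J :: "('n::finite, 'm::finite, 'k::field) bipoly set" and C +
  fixes e :: "'a::{finite,linorder} \<Rightarrow> 'n + 'm" and \<alpha> :: "int \<times> int \<Rightarrow> int"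
  assumes inj_e: "inj e"
    and \<alpha>_add: "\<alpha> (c + d) = \<alpha> c + \<alpha> d"
    and \<alpha>_e: "\<alpha> (vdeg (e i)) = 1"
    and \<alpha>_other: "x \<notin> range e \<Longrightarrow> \<alpha> (vdeg x) = 0"
    and \<alpha>_nonneg: "\<alpha> (bideg (u :: ('n + 'm) \<Rightarrow>\<^sub>0 nat)) \<ge> 0"
    and \<alpha>_pos: "\<alpha> (bideg (u :: ('n + 'm) \<Rightarrow>\<^sub>0 nat)) > 0 \<Longrightarrow> \<exists>i. Poly_Mapping.lookup u (e i) \<noteq> 0"
    and J_proper: "J \<noteq> UNIV"
    and almost_reg: "almost_regular (\<lambda>a. {f. \<forall>u\<in>Poly_Mapping.keys f. \<alpha> (bideg u) = a})
      (partial_ideal J (\<lambda>i. var (e i)) i) (var (e i))"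
begin

definition part :: "int \<Rightarrow> ('n, 'm, 'k) bipoly set" where
  "part a = {f. \<forall>u\<in>Poly_Mapping.keys f. \<alpha> (bideg u) = a}"

definition ann_degrees :: "'a \<Rightarrow> int set" where
  "ann_degrees i = {a. ann_nonzero part (partial_ideal J (\<lambda>i. var (e i)) i) (var (e i)) a}"

definition ann_top :: "'a \<Rightarrow> int" where
  "ann_top i = Max (ann_degrees i \<union> {0})"

definition ann_max :: int where
  "ann_max = Max (range ann_top)"

lemma e_notin: "k \<notin> D \<Longrightarrow> e k \<notin> e ` D"
  using inj_e by (auto dest: injD)

text \<open>An element of one \<open>\<alpha>\<close>-degree that is annihilated modulo the ideal
  but not in it has a bihomogeneous component with the same properties, so the annihilator may be
  tested in single bidegrees, where it is the kernel of \<open>e i\<close> on H_0.\<close>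

lemma ann_degrees_iff:
  "a \<in> ann_degrees i \<longleftrightarrow> (\<exists>d. \<alpha> d = a \<and> \<not> regular_at (e ` {..<i}) (e i) 0 d)"
proof -
  let ?V = "e ` {..<i}"
  have V: "partial_ideal J (\<lambda>i. var (e i)) i = plus_vars J ?V"
    by (simp add: partial_ideal_def plus_vars_def image_image)
  have "a \<in> ann_degrees i \<longleftrightarrow> (\<exists>g\<in>part a. var (e i) * g \<in> plus_vars J ?V \<and> g \<notin> plus_vars J ?V)"
    unfolding ann_degrees_def V mem_Collect_eq
    by (rule ann_nonzero_iff[OF plus_vars_ideal]) (simp add: part_def)
  also have "\<dots> \<longleftrightarrow> (\<exists>d. \<alpha> d = a \<and> (\<exists>g\<in>bipart d. var (e i) * g \<in> plus_vars J ?V \<and> g \<notin> plus_vars J ?V))"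
  proof (intro iffI)
    assume "\<exists>g\<in>part a. var (e i) * g \<in> plus_vars J ?V \<and> g \<notin> plus_vars J ?V"
    then obtain g where g: "g \<in> part a" "var (e i) * g \<in> plus_vars J ?V" "g \<notin> plus_vars J ?V" by blast
    have "\<exists>d\<in>bideg ` Poly_Mapping.keys g. hcomp d g \<notin> plus_vars J ?V"
    proof (rule ccontr)
      assume "\<not> ?thesis"
      then have "(\<Sum>d\<in>bideg ` Poly_Mapping.keys g. hcomp d g) \<in> plus_vars J ?V"
        by (intro ideal_sum[OF plus_vars_ideal]) blast
      then show False using g(3) by (simp only: sum_hcomp)
    qed
    then obtain d where d: "d \<in> bideg ` Poly_Mapping.keys g" "hcomp d g \<notin> plus_vars J ?V" by blast
    have "hcomp (vdeg (e i) + d) (var (e i) * g) \<in> plus_vars J ?V"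
      using plus_vars_hclosed[OF J_hclosed, of ?V] g(2) unfolding hclosed_def by blast
    then have "var (e i) * hcomp d g \<in> plus_vars J ?V"
      by (simp add: hcomp_mult_left[OF var_bipart])
    then show "\<exists>d. \<alpha> d = a \<and> (\<exists>g\<in>bipart d. var (e i) * g \<in> plus_vars J ?V \<and> g \<notin> plus_vars J ?V)"
      using g(1) d hcomp_in_bipart[of d g] by (intro exI[of _ d]) (auto simp: part_def)
  next
    assume "\<exists>d. \<alpha> d = a \<and> (\<exists>g\<in>bipart d. var (e i) * g \<in> plus_vars J ?V \<and> g \<notin> plus_vars J ?V)"
    moreover have "bipart d \<subseteq> part (\<alpha> d)" for d by (auto simp: part_def bipart_iff)
    ultimately show "\<exists>g\<in>part a. var (e i) * g \<in> plus_vars J ?V \<and> g \<notin> plus_vars J ?V" by blast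
  qed
  also have "\<dots> \<longleftrightarrow> (\<exists>d. \<alpha> d = a \<and> \<not> regular_at ?V (e i) 0 d)"
    unfolding regular_at_0_iff[OF e_notin[of i "{..<i}", simplified]] by blast
  finally show ?thesis .
qed

text \<open>Almost regularity bounds the degrees from above, and there are no negative degrees.
  Without finiteness the maximum in \<open>ann_top\<close> would be meaningless.\<close>

lemma finite_ann_degrees: "finite (ann_degrees i)"
proof -
  obtain a0 where a0: "\<And>a. a \<ge> a0 \<Longrightarrow> a \<notin> ann_degrees i"
    using almost_reg[of i] by (auto simp: almost_regular_def ann_degrees_def part_def[abs_def])
  have "a \<ge> 0" if a: "a \<in> ann_degrees i" for a
  proof -
    obtain g where g: "g \<in> part a" "g \<notin> partial_ideal J (\<lambda>i. var (e i)) i"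
      using a ann_nonzero_iff[of "partial_ideal J (\<lambda>i. var (e i)) i" part a "var (e i)"]
      by (auto simp: ann_degrees_def partial_ideal_def ideal_gen_ideal part_def)
    then have "g \<noteq> 0" using ideal_closed(1)[OF ideal_gen_ideal] by (auto simp: partial_ideal_def)
    then obtain u where "u \<in> Poly_Mapping.keys g" by fastforce
    then show ?thesis using g(1) \<alpha>_nonneg[of u] by (auto simp: part_def)
  qed
  moreover have "a < a0" if "a \<in> ann_degrees i" for a using a0 that by (meson not_less)
  ultimately have "ann_degrees i \<subseteq> {0..<a0}" by auto
  then show ?thesis by (rule finite_subset) simp
qed

lemma ann_max_nonneg: "ann_max \<ge> 0" and ann_top_le: "ann_top i \<le> ann_max"
proof -
  show le: "ann_top i \<le> ann_max" for i unfolding ann_max_def by (rule Max_ge) auto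
  have "0 \<le> ann_top i" for i unfolding ann_top_def using finite_ann_degrees by (intro Max_ge) auto
  with le show "ann_max \<ge> 0" using order_trans by blast
qed

lemma regular_above:
  assumes "\<alpha> d > ann_max" shows "regular_at (e ` {..<i}) (e i) 0 d"
proof (rule ccontr)
  assume "\<not> ?thesis"
  then have "\<alpha> d \<in> ann_degrees i" unfolding ann_degrees_iff by blast
  then have "\<alpha> d \<le> ann_top i" unfolding ann_top_def using finite_ann_degrees by (intro Max_ge) auto
  then show False using assms ann_top_le[of i] by simp
qed

lemma regular_of_acyclic: "acyclic_at V i d \<Longrightarrow> regular_at V x i d"
  by (auto simp: acyclic_at_def regular_at_def)

text \<open>If x maps a nonzero group into a zero group, it annihilates something.\<close>

lemma not_regular_of_acyclic:
  assumes "x \<notin> V" "\<not> acyclic_at V i d" "acyclic_at V i (d + vdeg x)"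
  shows "\<not> regular_at V x i d"
proof -
  obtain z where z: "z \<in> cycles V i d" "z \<notin> boundaries V i d" using assms(2) by (auto simp: acyclic_at_def)
  then have "smul (var x) z \<in> cycles V i (d + vdeg x)"
    using cycles_smul_var[OF assms(1) cycles_chains[OF z(1)]] by simp
  then show ?thesis using z assms(3) unfolding acyclic_at_def regular_at_def by blast
qed

text \<open>The sets D closed under smaller indices are the initial segments of the sequence.
  Killing the next variable enlarges the homology at index i + 1 by what it annihilates at index i,
  with \<open>\<alpha>\<close> raised by one, which matches the bound. For i = 0 the bound on the
  annihilators takes the place of the induction hypothesis.\<close>

lemma acyclic_sequence:
  assumes "\<forall>k\<in>D. {..<k} \<subseteq> D" "\<alpha> d > ann_max + int (Suc i)"
  shows "acyclic_at (e ` D) (Suc i) d"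
  using finite[of D] assms
proof (induction D arbitrary: d i rule: finite_linorder_max_induct)
  case empty
  show ?case by (simp add: acyclic_empty)
next
  case (insert k D)
  have D: "D = {..<k}" using insert.hyps insert.prems(1) by auto
  then have down: "\<forall>j\<in>D. {..<j} \<subseteq> D" by auto
  have IH: "acyclic_at (e ` D) (Suc i) d" if "\<alpha> d > ann_max + int (Suc i)" for d i
    by (rule insert.IH[OF down that])
  define c where "c = d - vdeg (e k)"
  have d: "d = c + vdeg (e k)" by (simp add: c_def)
  have \<alpha>c: "\<alpha> c > ann_max + int i" using insert.prems(2) by (simp add: d \<alpha>_add \<alpha>_e)
  have "regular_at (e ` D) (e k) i c"
  proof (cases i)
    case 0
    then show ?thesis using regular_above \<alpha>c by (simp add: D)
  next
    case (Suc i')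
    then show ?thesis using IH \<alpha>c by (intro regular_of_acyclic) simp
  qed
  then have "acyclic_at (insert (e k) (e ` D)) (Suc i) d"
    unfolding d using IH insert.prems(2) d by (intro acyclic_insert_Suc e_notin) (auto simp: D)
  then show ?case by simp
qed

text \<open>Once all \<open>e i\<close> are killed, H_0 lives in \<open>\<alpha>\<close>-degree 0
  and the bound holds for i = 0 too. Killing one of the other variables moves homology from index i
  to index i + 1 without changing \<open>\<alpha>\<close>, and there the bound is weaker.\<close>

lemma acyclic_all:
  assumes "W \<inter> range e = {}" "\<alpha> d > ann_max + int i"
  shows "acyclic_at (range e \<union> W) i d"
  using finite[of W] assms
proof (induction W arbitrary: d i rule: finite_induct)
  case empty
  show ?case
  proof (cases i)
    case 0
    have "f \<in> plus_vars J (range e)" if "f \<in> bipart d" for f :: "('n, 'm, 'k) bipoly"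
    proof (rule proj_0_in_plus_vars)
      have "\<alpha> d > 0" using empty.prems(2) ann_max_nonneg by simp
      then show "proj (range e) f = 0"
        using that \<alpha>_pos by (fastforce simp: proj_def restr_eq_0_iff bipart_iff)
    qed
    then show ?thesis using 0 by (auto simp: acyclic_at_0_iff)
  next
    case (Suc i')
    then show ?thesis using acyclic_sequence[of UNIV i' d] empty.prems by simp
  qed
next
  case (insert x W)
  then have x: "x \<notin> range e" "x \<notin> range e \<union> W" by auto
  define c where "c = d - vdeg x"
  have d: "d = c + vdeg x" by (simp add: c_def)
  have \<alpha>c: "\<alpha> c = \<alpha> d" using \<alpha>_other[OF x(1)] by (simp add: d \<alpha>_add)
  have IH: "acyclic_at (range e \<union> W) i d" if "\<alpha> d > ann_max + int i" for d i
    using insert.IH insert.prems(1) that by auto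
  have "acyclic_at (insert x (range e \<union> W)) i d"
  proof (cases i)
    case 0
    then show ?thesis using IH[of i d] insert.prems(2) by (simp add: acyclic_insert_0)
  next
    case (Suc i')
    have "acyclic_at (range e \<union> W) i' c" using IH \<alpha>c insert.prems(2) Suc by simp
    then show ?thesis
      unfolding Suc d using IH insert.prems(2) x(2) Suc d
      by (intro acyclic_insert_Suc regular_of_acyclic) auto
  qed
  then show ?case by simp
qed

text \<open>The class starts as an element of the annihilator of \<open>e k\<close> in the critical
  degree. Each further variable multiplies it into a degree above the upper bound, hence annihilates
  it, and so lifts it to the next homological index.\<close>

lemma not_acyclic_sequence:
  assumes "\<forall>j\<in>D. {..<j} \<subseteq> D" "k \<in> D" "ann_top k = ann_max" "ann_max > 0"
  shows "\<exists>i d. \<alpha> d = ann_max + int (Suc i) \<and> \<not> acyclic_at (e ` D) (Suc i) d"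
  using finite[of D] assms(1,2)
proof (induction D rule: finite_linorder_max_induct)
  case empty
  then show ?case by simp
next
  case (insert b D)
  have D: "D = {..<b}" using insert.hyps insert.prems(1) by auto
  have down: "\<forall>j\<in>D. {..<j} \<subseteq> D" by (auto simp: D)
  have "\<exists>i d. \<alpha> d = ann_max + int i \<and> \<not> regular_at (e ` D) (e b) i d"
  proof (cases "b = k")
    case True
    have "Max (ann_degrees k \<union> {0}) \<in> ann_degrees k \<union> {0}"
      using finite_ann_degrees by (intro Max_in) auto
    then have "ann_max \<in> ann_degrees k" using assms(3,4) by (auto simp: ann_top_def)
    then obtain d where "\<alpha> d = ann_max" "\<not> regular_at (e ` {..<k}) (e k) 0 d"
      unfolding ann_degrees_iff by blast
    then show ?thesis unfolding True D by (intro exI[of _ 0] exI[of _ d]) simp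
  next
    case False
    then have "k \<in> D" using insert.prems(2) by simp
    then obtain i d where id: "\<alpha> d = ann_max + int (Suc i)" "\<not> acyclic_at (e ` D) (Suc i) d"
      using insert.IH down by blast
    have "acyclic_at (e ` D) (Suc i) (d + vdeg (e b))"
      using id(1) by (intro acyclic_sequence[OF down]) (simp add: \<alpha>_add \<alpha>_e)
    then have "\<not> regular_at (e ` D) (e b) (Suc i) d"
      by (intro not_regular_of_acyclic id(2) e_notin) (auto simp: D)
    then show ?thesis using id(1) by blast
  qed
  then obtain i d where id: "\<alpha> d = ann_max + int i" "\<not> regular_at (e ` D) (e b) i d" by blast
  have "\<not> acyclic_at (insert (e b) (e ` D)) (Suc i) (d + vdeg (e b))"
    by (intro not_acyclic_insert_Suc id(2) e_notin) (simp add: D)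
  then show ?case using id(1) by (intro exI[of _ i] exI[of _ "d + vdeg (e b)"]) (simp add: \<alpha>_add \<alpha>_e)
qed

text \<open>The finitely many basis elements of the i-th free module bound the total degrees from
  below.\<close>

lemma acyclic_low_degree: "\<exists>b. \<forall>d. fst d + snd d < b \<longrightarrow> acyclic_at V i d"
proof -
  let ?t = "\<lambda>j. fst (bdeg C i j) + snd (bdeg C i j)"
  define b where "b = Min (insert 0 (?t ` {..<rnk C i}))"
  have "acyclic_at V i d" if d: "fst d + snd d < b" for d
  proof -
    have "z = 0" if "z \<in> chains V i d" for z
    proof
      fix j
      show "z j = 0 j"
      proof (cases "j < rnk C i")
        case True
        then have "b \<le> ?t j" unfolding b_def by (intro Min_le) auto
        have "u \<notin> Poly_Mapping.keys (z j)" for u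
        proof
          assume "u \<in> Poly_Mapping.keys (z j)"
          then have "bideg u = d - bdeg C i j" using that by (auto simp: chains_def hvec_def bipart_iff)
          then have "fst (bideg u) + snd (bideg u) < 0" using d \<open>b \<le> ?t j\<close> by simp
          then show False using bideg_nonneg[of u] by simp
        qed
        then show ?thesis by (simp flip: keys_eq_empty) blast
      next
        case False
        then show ?thesis using chains_free_mod[OF that] by (simp add: free_mod_def)
      qed
    qed
    moreover have "0 \<in> boundaries V i d"
      unfolding boundaries_def using chains_closed(1) bd_linear(1) by (metis image_eqI)
    ultimately show ?thesis using cycles_chains unfolding acyclic_at_def by blast
  qed
  then show ?thesis by blast
qed

lemma vdeg_total: "fst (vdeg x) + snd (vdeg x) = 1"
  by (cases x) (auto simp: vdeg_def)

text \<open>Going down in steps of the degree of x, the homology must vanish at some point.\<close>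

lemma lowest_not_acyclic:
  assumes "\<not> acyclic_at V i d" "\<alpha> (vdeg x) = 0"
  shows "\<exists>c. \<alpha> (c + vdeg x) = \<alpha> d \<and> \<not> acyclic_at V i (c + vdeg x) \<and> acyclic_at V i c"
proof -
  obtain b where b: "\<And>d. fst d + snd d < b \<Longrightarrow> acyclic_at V i d" using acyclic_low_degree by blast
  show ?thesis using assms(1)
  proof (induction "nat (fst d + snd d - b + 1)" arbitrary: d rule: less_induct)
    case less
    define c where "c = d - vdeg x"
    have d: "d = c + vdeg x" by (simp add: c_def)
    show ?case
    proof (cases "acyclic_at V i c")
      case True
      then show ?thesis using less.prems d by blast
    next
      case False
      have "fst d + snd d \<ge> b" using b less.prems by (meson not_less)
      moreover have "fst c + snd c = fst d + snd d - 1" using vdeg_total[of x] by (simp add: d)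
      ultimately have "nat (fst c + snd c - b + 1) < nat (fst d + snd d - b + 1)" by simp
      moreover have "\<alpha> c = \<alpha> d" using assms(2) by (simp add: d \<alpha>_add)
      ultimately show ?thesis using less.hyps[OF _ False] by simp
    qed
  qed
qed

text \<open>Among the critical classes choose one of lowest degree in the direction of the variable
  that is killed next; it is not a multiple of that variable and survives.\<close>

lemma not_acyclic_all:
  assumes "W \<inter> range e = {}" "ann_max > 0"
  shows "\<exists>i d. \<alpha> d = ann_max + int i \<and> \<not> acyclic_at (range e \<union> W) i d"
  using finite[of W] assms(1)
proof (induction W rule: finite_induct)
  case empty
  have "ann_max \<in> range ann_top" unfolding ann_max_def by (rule Max_in) auto
  then obtain k where "ann_top k = ann_max" by auto
  then obtain i d where "\<alpha> d = ann_max + int (Suc i)" "\<not> acyclic_at (range e) (Suc i) d"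
    using not_acyclic_sequence[of UNIV k] assms(2) by blast
  then show ?case by (intro exI[of _ "Suc i"] exI[of _ d]) simp
next
  case (insert x W)
  then have x: "x \<notin> range e" "x \<notin> range e \<union> W" by auto
  obtain i d where id: "\<alpha> d = ann_max + int i" "\<not> acyclic_at (range e \<union> W) i d"
    using insert.IH insert.prems by auto
  obtain c where c: "\<alpha> (c + vdeg x) = \<alpha> d" "\<not> acyclic_at (range e \<union> W) i (c + vdeg x)"
    "acyclic_at (range e \<union> W) i c"
    using lowest_not_acyclic[OF id(2) \<alpha>_other[OF x(1)]] by blast
  have "\<not> acyclic_at (insert x (range e \<union> W)) i (c + vdeg x)"
    by (rule not_acyclic_insert[OF x(2) c(2,3)])
  then show ?case using c(1) id(1) by (intro exI[of _ i] exI[of _ "c + vdeg x"]) simp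
qed

text \<open>If all annihilators vanish in positive degrees, the maximum is attained by the class of
  1 in H_0.\<close>

theorem tor_top_degree:
  "(\<exists>i d. \<alpha> d = ann_max + int i \<and> \<not> acyclic_at UNIV i d) \<and>
   (\<forall>i d. \<not> acyclic_at UNIV i d \<longrightarrow> \<alpha> d \<le> ann_max + int i)"
proof
  have U: "range e \<union> - range e = UNIV" by blast
  show "\<forall>i d. \<not> acyclic_at UNIV i d \<longrightarrow> \<alpha> d \<le> ann_max + int i"
    using acyclic_all[of "- range e"] by (auto simp: U simp flip: not_le)
  show "\<exists>i d. \<alpha> d = ann_max + int i \<and> \<not> acyclic_at UNIV i d"
  proof (cases "ann_max = 0")
    case True
    have "\<alpha> 0 = 0" using \<alpha>_add[of 0 0] by simp
    moreover have "1 \<in> (bipart 0 :: ('n, 'm, 'k) bipoly set)" by (simp add: bipart_iff)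
    then have "\<not> acyclic_at UNIV 0 0"
      using one_notin_plus_vars[OF bigraded J_proper] by (auto simp: acyclic_at_0_iff)
    ultimately show ?thesis using True by (intro exI[of _ 0]) simp
  next
    case False
    then show ?thesis using not_acyclic_all[of "- range e"] ann_max_nonneg by (simp add: U)
  qed
qed

end

lemma Sup_ereal_eq_max:
  assumes "Q a" "\<And>b. Q b \<Longrightarrow> b \<le> (a :: int)"
  shows "Sup {ereal (real_of_int b) | b. Q b} = ereal (real_of_int a)"
  by (rule Sup_eqI) (use assms in auto)

theorem theorem2p2:
  fixes J :: "('n::{finite,linorder}, 'm::{finite,linorder}, 'k::field) bipoly set"
  assumes "infinite (UNIV :: 'k set)"
    and "bigraded_ideal J" and "J \<noteq> UNIV"
    and "almost_regular_seq_x J xvar"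
    and "almost_regular_seq_y J yvar"
  shows "reg_x J = ereal (real_of_int (Max (range (s_x J)))) \<and>
         reg_y J = ereal (real_of_int (Max (range (s_y J))))"
proof
  define C where "C = (SOME C. bigraded_free_resolution J C)"
  have "bigraded_free_resolution J C"
    unfolding C_def using bigraded_free_resolution_exists[OF assms(2)] by (rule someI_ex)
  with assms(2) interpret resolution J C by unfold_locales
  have betti: "betti J i d \<noteq> 0 \<longleftrightarrow> \<not> acyclic_at UNIV i d" for i d
    unfolding betti_def C_def[symmetric] Let_def by (rule dim_quotient_nonzero_iff)
  have xvar: "xvar = (\<lambda>i. var (Inl i) :: ('n, 'm, 'k) bipoly)" and yvar: "yvar = (\<lambda>i. var (Inr i) :: ('n, 'm, 'k) bipoly)"
    by (simp_all add: xvar_eq_var yvar_eq_var fun_eq_iff)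
  have xpart: "xpart = (\<lambda>a. {f :: ('n, 'm, 'k) bipoly. \<forall>u\<in>Poly_Mapping.keys f. fst (bideg u) = a})"
    and ypart: "ypart = (\<lambda>a. {f :: ('n, 'm, 'k) bipoly. \<forall>u\<in>Poly_Mapping.keys f. snd (bideg u) = a})"
    by (simp_all add: xpart_def ypart_def bideg_def fun_eq_iff)
  have some_var: "(0::int) < (\<Sum>i\<in>UNIV. int (f i)) \<Longrightarrow> \<exists>i. f i \<noteq> 0" for f :: "'z::finite \<Rightarrow> nat"
    by (rule ccontr) simp
  show "reg_x J = ereal (real_of_int (Max (range (s_x J))))"
  proof -
    interpret X: regularity_direction J C "Inl :: 'n \<Rightarrow> 'n + 'm" fst
    proof unfold_locales
      show "fst (vdeg x) = 0" if "x \<notin> range (Inl :: 'n \<Rightarrow> 'n + 'm)" for x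
        using that by (cases x) (auto simp: vdeg_def)
      show "\<exists>i. Poly_Mapping.lookup u (Inl i) \<noteq> 0" if "0 < fst (bideg u)" for u :: "'n + 'm \<Rightarrow>\<^sub>0 nat"
        using that some_var by (simp add: bideg_def xdeg_def)
      show "almost_regular (\<lambda>a. {f. \<forall>u\<in>Poly_Mapping.keys f. fst (bideg u) = a})
          (partial_ideal J (\<lambda>i. var (Inl i)) i) (var (Inl i))" for i
        using assms(4) by (auto simp: almost_regular_seq_x_def xvar xpart)
    qed (auto simp: vdeg_def bideg_nonneg assms(3))
    have s: "s_x J = X.ann_top"
      by (simp add: fun_eq_iff s_x_def X.ann_top_def X.ann_degrees_def X.part_def[abs_def] xvar xpart)
    have "reg_x J = ereal (real_of_int X.ann_max)"
      unfolding reg_x_def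
    proof (rule Sup_ereal_eq_max)
      show "\<exists>i b. betti J i (X.ann_max + int i, b) \<noteq> 0"
        using X.tor_top_degree by (metis betti prod.collapse)
      show "a \<le> X.ann_max" if *: "\<exists>i b. betti J i (a + int i, b) \<noteq> 0" for a
      proof -
        obtain i b where "\<not> acyclic_at UNIV i (a + int i, b)" using * unfolding betti by blast
        then have "fst (a + int i, b) \<le> X.ann_max + int i" using X.tor_top_degree by blast
        then show ?thesis by simp
      qed
    qed
    then show ?thesis by (simp add: X.ann_max_def s)
  qed
  show "reg_y J = ereal (real_of_int (Max (range (s_y J))))"
  proof -
    interpret Y: regularity_direction J C "Inr :: 'm \<Rightarrow> 'n + 'm" snd
    proof unfold_locales
      show "snd (vdeg x) = 0" if "x \<notin> range (Inr :: 'm \<Rightarrow> 'n + 'm)" for x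
        using that by (cases x) (auto simp: vdeg_def)
      show "\<exists>i. Poly_Mapping.lookup u (Inr i) \<noteq> 0" if "0 < snd (bideg u)" for u :: "'n + 'm \<Rightarrow>\<^sub>0 nat"
        using that some_var by (simp add: bideg_def ydeg_def)
      show "almost_regular (\<lambda>a. {f. \<forall>u\<in>Poly_Mapping.keys f. snd (bideg u) = a})
          (partial_ideal J (\<lambda>i. var (Inr i)) i) (var (Inr i))" for i
        using assms(5) by (auto simp: almost_regular_seq_y_def yvar ypart)
    qed (auto simp: vdeg_def bideg_nonneg assms(3))
    have s: "s_y J = Y.ann_top"
      by (simp add: fun_eq_iff s_y_def Y.ann_top_def Y.ann_degrees_def Y.part_def[abs_def] yvar ypart)
    have "reg_y J = ereal (real_of_int Y.ann_max)"
      unfolding reg_y_def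
    proof (rule Sup_ereal_eq_max)
      show "\<exists>i a. betti J i (a, Y.ann_max + int i) \<noteq> 0"
        using Y.tor_top_degree by (metis betti prod.collapse)
      show "b \<le> Y.ann_max" if *: "\<exists>i a. betti J i (a, b + int i) \<noteq> 0" for b
      proof -
        obtain i a where "\<not> acyclic_at UNIV i (a, b + int i)" using * unfolding betti by blast
        then have "snd (a, b + int i) \<le> Y.ann_max + int i" using Y.tor_top_degree by blast
        then show ?thesis by simp
      qed
    qed
    then show ?thesis by (simp add: Y.ann_max_def s)
  qed
qed

end
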